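(* Let $\mathcal H$ be a complete Heyting algebra. Then the functor $a_{\mathbf{Rel}}=\Delta_{\mathbf{Inf}}\circ\Theta_{\mathbf{Pre}}:\mathbf{Rel}^{\mathcal H^{co}}_{\mathbf{Ord}}\to\mathbf{Rel}^{\mathcal H^{co}}_{\mathbf{Inf}}$ from relational-presheaves to relational-sheaves is left adjoint to the functor $\Delta_{\mathbf{Pre}}\circ\Theta_{\mathbf{Inf}}:\mathbf{Rel}^{\mathcal H^{co}}_{\mathbf{Inf}}\to\mathbf{Rel}^{\mathcal H^{co}}_{\mathbf{Ord}}$.
   Context: A relation $R:A\to B$ is a subset of $B\times A$; $R(b,a)=1$ means $(b,a)\in R$; $(S\circ R)(c,a)=1$ iff there is $b$ with $S(c,b)=1$ and $R(b,a)=1$; $R^{-1}$ is the inverse relation. A subset $X$ of a partial order is down-closed if $a\le b\in X$ implies $a\in X$; $h^\dagger=\{k\mid k\le h\}$ is a principal down-closed set. $\mathcal D\mathcal H$ is the complete Heyting algebra of all down-closed subsets of $\mathcal H$ (including $\emptyset$) ordered by inclusion. Let $\mathcal K$ be any complete Heyting algebra (below $\mathcal K=\mathcal H$ or $\mathcal D\mathcal H$). A family of relations $\tau=\langle\tau_h:A\to B\rangle_{h\in\mathcal K}$ is order-preserving (resp. infima-preserving) if for all $a\in A,b\in B$ the set $\{h\mid\tau_h(b,a)=1\}$ is down-closed (resp. principal down-closed). Order-preserving families are composed by: $(\sigma\tau)_h(c,a)=1$ iff there exist $k,l$ with $h\le k\wedge l$ and $(\sigma_k\circ\tau_l)(c,a)=1$.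 Infima-preserving families are composed by: $(\sigma\tau)_h(c,a)=1$ iff there is a (possibly empty) family $\langle k_i,l_i\rangle_{i\in I}$ with $h\le\bigvee_i(k_i\wedge l_i)$ and $(\sigma_{k_i}\circ\tau_{l_i})(c,a)=1$ for every $i$. Write $\tau\le\sigma$ if $\tau_h\subseteq\sigma_h$ for all $h$, and $\tau^\circ=\langle\tau_h^{-1}\rangle_h$. A relational-presheaf (resp. relational-sheaf) $F$ for $\mathcal K$ is a set $F( * )$ with an order-preserving (resp. infima-preserving) family $F=\langle F(h)\rangle_{h\in\mathcal K}:F( * )\to F( * )$ with $F^\circ=F$ and $FF=F$ (for the corresponding composition). A morphism $\theta:F\Rightarrow G$ is an order-preserving (resp. infima-preserving) family $\theta:F( * )\to G( * )$ with $\theta F=\theta=G\theta$, $F\le\theta^\circ\theta$, $\theta\theta^\circ\le G$. These form categories $\mathbf{Rel}^{\mathcal K^{co}}_{\mathbf{Ord}}$ (resp. $\mathbf{Rel}^{\mathcal K^{co}}_{\mathbf{Inf}}$), with $F$ as identity on $F$. For $h\in\mathcal K$, the singleton $S_h$ is the relational-sheaf with $S_h( * )=\{*\}$ and $S_h(k)( *,* )=1$ iff $k\le h$. For $k\le h$, $\alpha^{k,h}:S_k\Rightarrow S_h$ is the morphism with $\alpha^{k,h}_l( *,* )=1$ iff $l\le k$. $\mathbf{Set}^{\mathcal K^{op}}$ is the category of presheaves on $\mathcal K$; for $x\in F(h)$, $k\le h$, $x|_k=F(k\le h)(x)$. A matching family for $A\subseteq\mathcal K$ and $F$ is a family $\langle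 x_k\rangle_{k\in A}$ with $x_k\in F(k)$ and $x_k|_{k\wedge l}=x_l|_{k\wedge l}$ for all $k,l\in A$; $F$ is a sheaf if for every $A\subseteq\mathcal K$ and every matching family there is a unique $x\in F(\bigvee A)$ with $x|_k=x_k$ for all $k\in A$. $\mathbf{SHV}(\mathcal K)$ is the full subcategory of sheaves. $\Theta_{\mathbf{Inf}}:\mathbf{Rel}^{\mathcal K^{co}}_{\mathbf{Inf}}\to\mathbf{Set}^{\mathcal K^{op}}$: $\Theta_{\mathbf{Inf}}(G)(h)$ is the set of morphisms $\alpha:S_h\Rightarrow G$, with restriction along $k\le h$ sending $\alpha$ to $\alpha\,\alpha^{k,h}$; $\Theta_{\mathbf{Inf}}(\tau)_h(\alpha)=\tau\alpha$. Its values are sheaves; with codomain $\mathbf{SHV}(\mathcal K)$ it is denoted $\Theta_{\mathbf{Shv}}$. $\Delta_{\mathbf{Inf}}:\mathbf{Set}^{\mathcal K^{op}}\to\mathbf{Rel}^{\mathcal K^{co}}_{\mathbf{Inf}}$: $\Delta_{\mathbf{Inf}}(F)( * )=\coprod_{h\in\mathcal K}F(h)$, and for $a\in F(k)$, $b\in F(l)$, $\Delta_{\mathbf{Inf}}(F)(h)(b,a)=1$ iff $h\le\bigvee\{m\mid m\le k\wedge l,\ b|_m=a|_m\}$; for $\tau:F\Rightarrow G$, $a\in F(k)$, $b\in G(l)$, $\Delta_{\mathbf{Inf}}(\tau)_h(b,a)=1$ iff $h\le\bigvee\{m\mid m\le k\wedge l,\ b|_m=\tau_k(a)|_m\}$.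 Its restriction to $\mathbf{SHV}(\mathcal K)$ is denoted $\Delta_{\mathbf{Shv}}$. Comparison functors. $\Gamma:\mathbf{Set}^{\mathcal H^{op}}\to\mathbf{SHV}(\mathcal D\mathcal H)$: $\Gamma(F)(A)$ is the set of matching families for $A$ and $F$, restriction along $B\subseteq A$ restricts the family to indices in $B$, and $\Gamma(\tau)$ applies $\tau$ componentwise. $\Lambda:\mathbf{SHV}(\mathcal D\mathcal H)\to\mathbf{Set}^{\mathcal H^{op}}$: $\Lambda(F)(h)=F(h^\dagger)$, $\Lambda(F)(k\le h)=F(k^\dagger\subseteq h^\dagger)$, $\Lambda(\tau)_h=\tau_{h^\dagger}$. $\Psi:\mathbf{Rel}^{\mathcal H^{co}}_{\mathbf{Ord}}\to\mathbf{Rel}^{(\mathcal D\mathcal H)^{co}}_{\mathbf{Inf}}$ keeps the underlying set and sends a family $\tau$ (an object or a morphism) to $\Psi(\tau)$ with $\Psi(\tau)_X(b,a)=1$ iff $\tau_h(b,a)=1$ for all $h\in X$. $\Phi:\mathbf{Rel}^{(\mathcal D\mathcal H)^{co}}_{\mathbf{Inf}}\to\mathbf{Rel}^{\mathcal H^{co}}_{\mathbf{Ord}}$ keeps the underlying set and sends $\tau$ to $\Phi(\tau)$ with $\Phi(\tau)_h=\tau_{h^\dagger}$. Finally, with $\Delta_{\mathbf{Shv}},\Theta_{\mathbf{Shv}}$ taken for $\mathcal D\mathcal H$: $\Delta_{\mathbf{Pre}}=\Phi\circ\Delta_{\mathbf{Shv}}\circ\Gamma:\mathbf{Set}^{\mathcal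 H^{op}}\to\mathbf{Rel}^{\mathcal H^{co}}_{\mathbf{Ord}}$ and $\Theta_{\mathbf{Pre}}=\Lambda\circ\Theta_{\mathbf{Shv}}\circ\Psi:\mathbf{Rel}^{\mathcal H^{co}}_{\mathbf{Ord}}\to\mathbf{Set}^{\mathcal H^{op}}$. *)

theory Defs
  imports "HOL-Library.FuncSet"
begin

section \<open>Complete Heyting algebras\<close>

class complete_heyting_algebra = complete_lattice +
  assumes ex_relative_pseudocomplement: "\<exists>z. \<forall>w. w \<le> z \<longleftrightarrow> inf w x \<le> y"

definition down_closed :: "'k::order set \<Rightarrow> bool" where
  "down_closed X \<longleftrightarrow> (\<forall>a b. a \<le> b \<and> b \<in> X \<longrightarrow> a \<in> X)"

definition principal_down_closed :: "'k::order set \<Rightarrow> bool" where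
  "principal_down_closed X \<longleftrightarrow> (\<exists>h. X = {k. k \<le> h})"

text \<open>The type \<open>'h downset\<close> is the algebra of all down-closed subsets of \<open>'h\<close>.\<close>

typedef (overloaded) 'h downset = "{X :: 'h::order set. down_closed X}"
  morphisms elems Downset
  by (rule exI[of _ "{}"]) (simp add: down_closed_def)

lemma down_closed_elems: "down_closed (elems A)"
  using elems by auto

lemma elems_Downset: "down_closed X \<Longrightarrow> elems (Downset X) = X"
  by (simp add: Downset_inverse)

instantiation downset :: (order) complete_lattice
begin

definition less_eq_downset :: "'a downset \<Rightarrow> 'a downset \<Rightarrow> bool" where
  "A \<le> B \<longleftrightarrow> elems A \<subseteq> elems B"
definition less_downset :: "'a downset \<Rightarrow> 'a downset \<Rightarrow> bool" where
  "A < B \<longleftrightarrow> elems A \<subset> elems B"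
definition inf_downset :: "'a downset \<Rightarrow> 'a downset \<Rightarrow> 'a downset" where
  "inf A B = Downset (elems A \<inter> elems B)"
definition sup_downset :: "'a downset \<Rightarrow> 'a downset \<Rightarrow> 'a downset" where
  "sup A B = Downset (elems A \<union> elems B)"
definition bot_downset :: "'a downset" where
  "bot = Downset {}"
definition top_downset :: "'a downset" where
  "top = Downset UNIV"
definition Inf_downset :: "'a downset set \<Rightarrow> 'a downset" where
  "Inf \<A> = Downset (\<Inter>A\<in>\<A>. elems A)"
definition Sup_downset :: "'a downset set \<Rightarrow> 'a downset" where
  "Sup \<A> = Downset (\<Union>A\<in>\<A>. elems A)"

lemma elems_inf: "elems (inf A B) = elems A \<inter> elems (B :: 'a downset)"
  unfolding inf_downset_def using down_closed_elems[of A] down_closed_elems[of B]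
  by (intro elems_Downset) (auto simp: down_closed_def)

lemma elems_sup: "elems (sup A B) = elems A \<union> elems (B :: 'a downset)"
  unfolding sup_downset_def using down_closed_elems[of A] down_closed_elems[of B]
  by (intro elems_Downset) (auto simp: down_closed_def)

lemma elems_bot: "elems (bot :: 'a downset) = {}"
  unfolding bot_downset_def by (intro elems_Downset) (auto simp: down_closed_def)

lemma elems_top: "elems (top :: 'a downset) = UNIV"
  unfolding top_downset_def by (intro elems_Downset) (auto simp: down_closed_def)

lemma elems_Inf: "elems (Inf \<A>) = (\<Inter>A\<in>\<A>. elems (A :: 'a downset))"
  unfolding Inf_downset_def using down_closed_elems
  by (intro elems_Downset) (fastforce simp: down_closed_def)

lemma elems_Sup: "elems (Sup \<A>) = (\<Union>A\<in>\<A>. elems (A :: 'a downset))"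
  unfolding Sup_downset_def using down_closed_elems
  by (intro elems_Downset) (fastforce simp: down_closed_def)

instance
  by standard
    (auto simp: less_eq_downset_def less_downset_def elems_inf elems_sup elems_bot elems_top
      elems_Inf elems_Sup elems_inject,
     simp_all add: Inf_downset_def Sup_downset_def top_downset_def bot_downset_def)

end

instance downset :: (order) complete_heyting_algebra
proof
  fix x y :: "'a downset"
  have "w \<le> Sup {v. inf v x \<le> y} \<longleftrightarrow> inf w x \<le> y" for w
  proof
    assume "w \<le> Sup {v. inf v x \<le> y}"
    then show "inf w x \<le> y"
      by (fastforce simp: less_eq_downset_def elems_inf elems_Sup)
  qed (simp add: Sup_upper)
  then show "\<exists>z. \<forall>w. w \<le> z \<longleftrightarrow> inf w x \<le> y" by blast
qed

definition principal :: "'h::order \<Rightarrow> 'h downset" where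
  "principal h = Downset {k. k \<le> h}"


section \<open>Families of relations\<close>

text \<open>
  A relation \<open>A \<rightarrow> B\<close> is a subset of \<open>B \<times> A\<close>, so composition of relations is the library's \<open>O\<close>.
  Families carry their source and target sets. This matters for infima-preserving families:
  their member at \<open>bot\<close> is always the full relation, relative to the two sets.
\<close>

record ('k, 'a, 'b) relfam =
  src :: "'a set"
  tgt :: "'b set"
  rel :: "'k \<Rightarrow> ('b \<times> 'a) set"

definition relation_family :: "('k, 'a, 'b) relfam \<Rightarrow> bool" where
  "relation_family \<tau> \<longleftrightarrow> (\<forall>h. rel \<tau> h \<subseteq> tgt \<tau> \<times> src \<tau>)"

definition order_preserving :: "('k::order, 'a, 'b) relfam \<Rightarrow> bool" where
  "order_preserving \<tau> \<longleftrightarrow> relation_family \<tau> \<and>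
     (\<forall>a\<in>src \<tau>. \<forall>b\<in>tgt \<tau>. down_closed {h. (b, a) \<in> rel \<tau> h})"

definition infima_preserving :: "('k::order, 'a, 'b) relfam \<Rightarrow> bool" where
  "infima_preserving \<tau> \<longleftrightarrow> relation_family \<tau> \<and>
     (\<forall>a\<in>src \<tau>. \<forall>b\<in>tgt \<tau>. principal_down_closed {h. (b, a) \<in> rel \<tau> h})"

definition ord_comp ::
  "('k::complete_lattice, 'b, 'c) relfam \<Rightarrow> ('k, 'a, 'b) relfam \<Rightarrow> ('k, 'a, 'c) relfam" where
  "ord_comp \<sigma> \<tau> = \<lparr> src = src \<tau>, tgt = tgt \<sigma>,
     rel = (\<lambda>h. {(c, a) \<in> tgt \<sigma> \<times> src \<tau>.
       \<exists>k l. h \<le> inf k l \<and> (c, a) \<in> rel \<sigma> k O rel \<tau> l}) \<rparr>"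

text \<open>
  The family of pairs \<open>(k\<^sub>i, l\<^sub>i)\<close> indexed by \<open>I\<close> is given by its set \<open>P\<close> of values, which
  may be empty.
\<close>

definition inf_comp ::
  "('k::complete_lattice, 'b, 'c) relfam \<Rightarrow> ('k, 'a, 'b) relfam \<Rightarrow> ('k, 'a, 'c) relfam" where
  "inf_comp \<sigma> \<tau> = \<lparr> src = src \<tau>, tgt = tgt \<sigma>,
     rel = (\<lambda>h. {(c, a) \<in> tgt \<sigma> \<times> src \<tau>.
       \<exists>P. h \<le> Sup {inf k l | k l. (k, l) \<in> P} \<and>
           (\<forall>(k, l)\<in>P. (c, a) \<in> rel \<sigma> k O rel \<tau> l)}) \<rparr>"

definition fam_le :: "('k, 'a, 'b) relfam \<Rightarrow> ('k, 'a, 'b) relfam \<Rightarrow> bool" where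
  "fam_le \<tau> \<sigma> \<longleftrightarrow> (\<forall>h. rel \<tau> h \<subseteq> rel \<sigma> h)"

definition fam_conv :: "('k, 'a, 'b) relfam \<Rightarrow> ('k, 'b, 'a) relfam" where
  "fam_conv \<tau> = \<lparr> src = tgt \<tau>, tgt = src \<tau>, rel = (\<lambda>h. (rel \<tau> h)\<inverse>) \<rparr>"


section \<open>Categories and functors\<close>

record ('o, 'm) cat =
  Obj :: "'o set"
  Hom :: "'o \<Rightarrow> 'o \<Rightarrow> 'm set"
  Comp :: "'m \<Rightarrow> 'm \<Rightarrow> 'm"
  Ident :: "'o \<Rightarrow> 'm"

definition category :: "('o, 'm) cat \<Rightarrow> bool" where
  "category C \<longleftrightarrow>
     (\<forall>X\<in>Obj C. Ident C X \<in> Hom C X X) \<and>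
     (\<forall>X\<in>Obj C. \<forall>Y\<in>Obj C. \<forall>f\<in>Hom C X Y.
        Comp C f (Ident C X) = f \<and> Comp C (Ident C Y) f = f) \<and>
     (\<forall>X\<in>Obj C. \<forall>Y\<in>Obj C. \<forall>Z\<in>Obj C. \<forall>f\<in>Hom C X Y. \<forall>g\<in>Hom C Y Z.
        Comp C g f \<in> Hom C X Z) \<and>
     (\<forall>W\<in>Obj C. \<forall>X\<in>Obj C. \<forall>Y\<in>Obj C. \<forall>Z\<in>Obj C.
        \<forall>f\<in>Hom C W X. \<forall>g\<in>Hom C X Y. \<forall>h\<in>Hom C Y Z.
        Comp C h (Comp C g f) = Comp C (Comp C h g) f)"

text \<open>
  A morphism need not determine its domain and codomain objects, so the action of a functor on
  morphisms takes them as arguments: \<open>on_mor T X Y f\<close> is the image of \<open>f : X \<rightarrow> Y\<close>.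
\<close>

record ('o, 'm, 'p, 'n) func =
  on_obj :: "'o \<Rightarrow> 'p"
  on_mor :: "'o \<Rightarrow> 'o \<Rightarrow> 'm \<Rightarrow> 'n"

definition func_comp ::
  "('p, 'n, 'q, 'r) func \<Rightarrow> ('o, 'm, 'p, 'n) func \<Rightarrow> ('o, 'm, 'q, 'r) func"
  (infixr "\<circ>F" 55) where
  "S \<circ>F T = \<lparr> on_obj = (\<lambda>X. on_obj S (on_obj T X)),
     on_mor = (\<lambda>X Y f. on_mor S (on_obj T X) (on_obj T Y) (on_mor T X Y f)) \<rparr>"

definition is_functor ::
  "('o, 'm) cat \<Rightarrow> ('p, 'n) cat \<Rightarrow> ('o, 'm, 'p, 'n) func \<Rightarrow> bool" where
  "is_functor C D T \<longleftrightarrow> category C \<and> category D \<and>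
     (\<forall>X\<in>Obj C. on_obj T X \<in> Obj D) \<and>
     (\<forall>X\<in>Obj C. \<forall>Y\<in>Obj C. \<forall>f\<in>Hom C X Y.
        on_mor T X Y f \<in> Hom D (on_obj T X) (on_obj T Y)) \<and>
     (\<forall>X\<in>Obj C. on_mor T X X (Ident C X) = Ident D (on_obj T X)) \<and>
     (\<forall>X\<in>Obj C. \<forall>Y\<in>Obj C. \<forall>Z\<in>Obj C. \<forall>f\<in>Hom C X Y. \<forall>g\<in>Hom C Y Z.
        on_mor T X Z (Comp C g f) = Comp D (on_mor T Y Z g) (on_mor T X Y f))"


section \<open>Relational-presheaves and relational-sheaves\<close>

text \<open>The underlying set \<open>F(*)\<close> is \<open>src F = tgt F\<close>.\<close>

definition rel_presheaf :: "('k::complete_lattice, 'a, 'a) relfam \<Rightarrow> bool" where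
  "rel_presheaf F \<longleftrightarrow> src F = tgt F \<and> order_preserving F \<and>
     fam_conv F = F \<and> ord_comp F F = F"

definition rel_sheaf :: "('k::complete_lattice, 'a, 'a) relfam \<Rightarrow> bool" where
  "rel_sheaf F \<longleftrightarrow> src F = tgt F \<and> infima_preserving F \<and>
     fam_conv F = F \<and> inf_comp F F = F"

definition hom_Ord :: "('k::complete_lattice, 'a, 'a) relfam \<Rightarrow> ('k, 'b, 'b) relfam \<Rightarrow>
    ('k, 'a, 'b) relfam set" where
  "hom_Ord F G = {\<theta>. src \<theta> = src F \<and> tgt \<theta> = tgt G \<and> order_preserving \<theta> \<and>
     ord_comp \<theta> F = \<theta> \<and> ord_comp G \<theta> = \<theta> \<and>
     fam_le F (ord_comp (fam_conv \<theta>) \<theta>) \<and> fam_le (ord_comp \<theta> (fam_conv \<theta>)) G}"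

definition hom_Inf :: "('k::complete_lattice, 'a, 'a) relfam \<Rightarrow> ('k, 'b, 'b) relfam \<Rightarrow>
    ('k, 'a, 'b) relfam set" where
  "hom_Inf F G = {\<theta>. src \<theta> = src F \<and> tgt \<theta> = tgt G \<and> infima_preserving \<theta> \<and>
     inf_comp \<theta> F = \<theta> \<and> inf_comp G \<theta> = \<theta> \<and>
     fam_le F (inf_comp (fam_conv \<theta>) \<theta>) \<and> fam_le (inf_comp \<theta> (fam_conv \<theta>)) G}"

definition Rel_Ord ::
  "(('k::complete_lattice, 'a, 'a) relfam, ('k, 'a, 'a) relfam) cat" where
  "Rel_Ord = \<lparr> Obj = {F. rel_presheaf F}, Hom = hom_Ord, Comp = ord_comp, Ident = (\<lambda>F. F) \<rparr>"

definition Rel_Inf ::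
  "(('k::complete_lattice, 'a, 'a) relfam, ('k, 'a, 'a) relfam) cat" where
  "Rel_Inf = \<lparr> Obj = {F. rel_sheaf F}, Hom = hom_Inf, Comp = inf_comp, Ident = (\<lambda>F. F) \<rparr>"

definition singleton_sheaf :: "'k::complete_lattice \<Rightarrow> ('k, unit, unit) relfam" where
  "singleton_sheaf h = \<lparr> src = {()}, tgt = {()}, rel = (\<lambda>k. {((), ()) | _::unit. k \<le> h}) \<rparr>"

definition singleton_map ::
  "'k::complete_lattice \<Rightarrow> 'k \<Rightarrow> ('k, unit, unit) relfam" where
  "singleton_map k h = \<lparr> src = {()}, tgt = {()}, rel = (\<lambda>l. {((), ()) | _::unit. l \<le> k}) \<rparr>"


section \<open>Presheaves and the functors between presheaves and relational families\<close>

text \<open>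
  A presheaf \<open>F\<close> has sections \<open>F(h) = sec F h\<close>, and \<open>res F h k\<close> (for \<open>k \<le> h\<close>) is the
  restriction from \<open>F(h)\<close> to \<open>F(k)\<close>. A natural transformation is given by its
  components, of type \<open>'k \<Rightarrow> 'x \<Rightarrow> 'y\<close>. Only the values of restrictions and components on sections
  are meaningful.
\<close>

record ('k, 'x) psh =
  sec :: "'k \<Rightarrow> 'x set"
  res :: "'k \<Rightarrow> 'k \<Rightarrow> 'x \<Rightarrow> 'x"

definition Theta_Inf ::
  "(('k::complete_lattice, 'a, 'a) relfam, ('k, 'a, 'a) relfam,
    ('k, ('k, unit, 'a) relfam) psh,
    'k \<Rightarrow> ('k, unit, 'a) relfam \<Rightarrow> ('k, unit, 'a) relfam) func" where
  "Theta_Inf = \<lparr>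
     on_obj = (\<lambda>G. \<lparr> sec = (\<lambda>h. hom_Inf (singleton_sheaf h) G),
                     res = (\<lambda>h k \<alpha>. inf_comp \<alpha> (singleton_map k h)) \<rparr>),
     on_mor = (\<lambda>G G' \<tau> h \<alpha>. inf_comp \<tau> \<alpha>) \<rparr>"

text \<open>The coproduct of the sets \<open>F(h)\<close> is the set of pairs \<open>(h, x)\<close> with \<open>x \<in> F(h)\<close>.\<close>

definition coproduct :: "('k, 'x) psh \<Rightarrow> ('k \<times> 'x) set" where
  "coproduct F = (SIGMA h:UNIV. sec F h)"

definition Delta_Inf ::
  "(('k::complete_lattice, 'x) psh, 'k \<Rightarrow> 'x \<Rightarrow> 'x,
    ('k, 'k \<times> 'x, 'k \<times> 'x) relfam, ('k, 'k \<times> 'x, 'k \<times> 'x) relfam) func" where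
  "Delta_Inf = \<lparr>
     on_obj = (\<lambda>F. \<lparr> src = coproduct F, tgt = coproduct F,
       rel = (\<lambda>h. {((l, b), (k, a)). a \<in> sec F k \<and> b \<in> sec F l \<and>
         h \<le> Sup {m. m \<le> inf k l \<and> res F l m b = res F k m a}}) \<rparr>),
     on_mor = (\<lambda>F G \<tau>. \<lparr> src = coproduct F, tgt = coproduct G,
       rel = (\<lambda>h. {((l, b), (k, a)). a \<in> sec F k \<and> b \<in> sec G l \<and>
         h \<le> Sup {m. m \<le> inf k l \<and> res G l m b = res G k m (\<tau> k a)}}) \<rparr>) \<rparr>"


section \<open>Comparison functors\<close>

definition matching_families ::
  "'h::complete_lattice set \<Rightarrow> ('h, 'x) psh \<Rightarrow> ('h \<Rightarrow> 'x) set" where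
  "matching_families A F = {x \<in> (\<Pi>\<^sub>E k\<in>A. sec F k).
     \<forall>k\<in>A. \<forall>l\<in>A. res F k (inf k l) (x k) = res F l (inf k l) (x l)}"

definition Gamma ::
  "(('h::complete_heyting_algebra, 'x) psh, 'h \<Rightarrow> 'x \<Rightarrow> 'x,
    ('h downset, 'h \<Rightarrow> 'x) psh, 'h downset \<Rightarrow> ('h \<Rightarrow> 'x) \<Rightarrow> ('h \<Rightarrow> 'x)) func" where
  "Gamma = \<lparr>
     on_obj = (\<lambda>F. \<lparr> sec = (\<lambda>A. matching_families (elems A) F),
                     res = (\<lambda>A B x. restrict x (elems B)) \<rparr>),
     on_mor = (\<lambda>F G \<tau> A x. \<lambda>k\<in>elems A. \<tau> k (x k)) \<rparr>"

definition Lambda ::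
  "(('h::complete_heyting_algebra downset, 'x) psh, 'h downset \<Rightarrow> 'x \<Rightarrow> 'x,
    ('h, 'x) psh, 'h \<Rightarrow> 'x \<Rightarrow> 'x) func" where
  "Lambda = \<lparr>
     on_obj = (\<lambda>F. \<lparr> sec = (\<lambda>h. sec F (principal h)),
                     res = (\<lambda>h k. res F (principal h) (principal k)) \<rparr>),
     on_mor = (\<lambda>F G \<tau> h. \<tau> (principal h)) \<rparr>"

definition Psi_fam ::
  "('h::complete_heyting_algebra, 'a, 'b) relfam \<Rightarrow> ('h downset, 'a, 'b) relfam" where
  "Psi_fam \<tau> = \<lparr> src = src \<tau>, tgt = tgt \<tau>,
     rel = (\<lambda>X. {(b, a) \<in> tgt \<tau> \<times> src \<tau>. \<forall>h\<in>elems X. (b, a) \<in> rel \<tau> h}) \<rparr>"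

definition Phi_fam ::
  "('h::complete_heyting_algebra downset, 'a, 'b) relfam \<Rightarrow> ('h, 'a, 'b) relfam" where
  "Phi_fam \<tau> = \<lparr> src = src \<tau>, tgt = tgt \<tau>, rel = (\<lambda>h. rel \<tau> (principal h)) \<rparr>"

definition Psi ::
  "(('h::complete_heyting_algebra, 'a, 'a) relfam, ('h, 'a, 'a) relfam,
    ('h downset, 'a, 'a) relfam, ('h downset, 'a, 'a) relfam) func" where
  "Psi = \<lparr> on_obj = Psi_fam, on_mor = (\<lambda>F G. Psi_fam) \<rparr>"

definition Phi ::
  "(('h::complete_heyting_algebra downset, 'a, 'a) relfam, ('h downset, 'a, 'a) relfam,
    ('h, 'a, 'a) relfam, ('h, 'a, 'a) relfam) func" where
  "Phi = \<lparr> on_obj = Phi_fam, on_mor = (\<lambda>F G. Phi_fam) \<rparr>"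

text \<open>
  \<open>\<Delta>\<^sub>S\<^sub>h\<^sub>v\<close> and \<open>\<Theta>\<^sub>S\<^sub>h\<^sub>v\<close> are \<open>Delta_Inf\<close> and \<open>Theta_Inf\<close> with restricted domain or codomain, so
  they act by the same formulas.
\<close>

definition Delta_Pre ::
  "(('h::complete_heyting_algebra, 'x) psh, 'h \<Rightarrow> 'x \<Rightarrow> 'x,
    ('h, 'h downset \<times> ('h \<Rightarrow> 'x), 'h downset \<times> ('h \<Rightarrow> 'x)) relfam,
    ('h, 'h downset \<times> ('h \<Rightarrow> 'x), 'h downset \<times> ('h \<Rightarrow> 'x)) relfam) func" where
  "Delta_Pre = Phi \<circ>F Delta_Inf \<circ>F Gamma"

definition Theta_Pre ::
  "(('h::complete_heyting_algebra, 'a, 'a) relfam, ('h, 'a, 'a) relfam,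
    ('h, ('h downset, unit, 'a) relfam) psh,
    'h \<Rightarrow> ('h downset, unit, 'a) relfam \<Rightarrow> ('h downset, unit, 'a) relfam) func" where
  "Theta_Pre = Lambda \<circ>F Theta_Inf \<circ>F Psi"

definition a_Rel ::
  "(('h::complete_heyting_algebra, 'a, 'a) relfam, ('h, 'a, 'a) relfam,
    ('h, 'h \<times> ('h downset, unit, 'a) relfam, 'h \<times> ('h downset, unit, 'a) relfam) relfam,
    ('h, 'h \<times> ('h downset, unit, 'a) relfam, 'h \<times> ('h downset, unit, 'a) relfam) relfam)
   func" where
  "a_Rel = Delta_Inf \<circ>F Theta_Pre"


section \<open>Adjunctions between relational-presheaves and relational-sheaves\<close>

text \<open>
  \<open>L\<close> is left adjoint to \<open>R\<close>: there are bijections from \<open>Hom(L F, G)\<close> to \<open>Hom(F, R G)\<close>, natural in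
  \<open>F\<close> and \<open>G\<close>. The elements of \<open>F(*)\<close>, \<open>G(*)\<close>, \<open>(L F)(*)\<close> and \<open>(R G)(*)\<close> may have different
  types, since a type of HOL cannot contain its own function spaces. Hence \<open>Rel_Ord\<close> and \<open>Rel_Inf\<close>
  each occur at two types below, and \<open>hom_Inf\<close> and \<open>hom_Ord\<close> are taken between objects over
  different types.
\<close>

definition left_adjoint ::
  "(('k::complete_lattice, 'a, 'a) relfam, ('k, 'a, 'a) relfam,
    ('k, 'c, 'c) relfam, ('k, 'c, 'c) relfam) func \<Rightarrow>
   (('k, 'b, 'b) relfam, ('k, 'b, 'b) relfam,
    ('k, 'd, 'd) relfam, ('k, 'd, 'd) relfam) func \<Rightarrow> bool" where
  "left_adjoint L R \<longleftrightarrow> is_functor Rel_Ord Rel_Inf L \<and> is_functor Rel_Inf Rel_Ord R \<and>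
     (\<exists>\<phi> :: ('k, 'a, 'a) relfam \<Rightarrow> ('k, 'b, 'b) relfam \<Rightarrow>
            ('k, 'c, 'b) relfam \<Rightarrow> ('k, 'a, 'd) relfam.
       (\<forall>F G. rel_presheaf F \<and> rel_sheaf G \<longrightarrow>
          bij_betw (\<phi> F G) (hom_Inf (on_obj L F) G) (hom_Ord F (on_obj R G))) \<and>
       (\<forall>F F' G G' f g t. rel_presheaf F \<and> rel_presheaf F' \<and> rel_sheaf G \<and> rel_sheaf G' \<and>
          f \<in> hom_Ord F' F \<and> g \<in> hom_Inf G G' \<and> t \<in> hom_Inf (on_obj L F) G \<longrightarrow>
          \<phi> F' G' (inf_comp g (inf_comp t (on_mor L F' F f))) =
            ord_comp (on_mor R G G' g) (ord_comp (\<phi> F G t) f)))"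

end

theory Submission
  imports Defs
begin

text \<open>
  Infima-preserving families over \<open>K\<close> are \<open>K\<close>-valued matrices, so relational-sheaves are
  \<open>K\<close>-valued sets and their morphisms are functional relations; order-preserving families are
  decreasing families of relations, that is, matrices over the down-closed sets.
  Two adjunctions are composed. A morphism from \<open>Delta_Inf P\<close> to a relational-sheaf \<open>G\<close> is
  determined by its rows, which form a natural transformation from \<open>P\<close> to \<open>Theta_Inf G\<close>.
  For a relational-presheaf \<open>F\<close>, a section of \<open>Theta_Pre F\<close> at \<open>h\<close> is the germ at \<open>h\<close> of some
  \<open>a \<in> F(*)\<close> with \<open>F(h)(a, a) = 1\<close>: a principal down-closed set covered by a union lies in one of
  its members. Hence a morphism from \<open>F\<close> to \<open>Delta_Pre Q\<close> amounts to a natural transformation from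
  \<open>Theta_Pre F\<close> to \<open>Q\<close>. Take \<open>P = Theta_Pre F\<close> and \<open>Q = Theta_Inf G\<close>.
\<close>

section \<open>Infima-preserving families as matrices\<close>

text \<open>The natural transformations between \<open>Theta_Pre F\<close> and
  \<open>Theta_Inf G\<close> are never collected into a set: a component is a function on a whole
  type with arbitrary values off sections, so different functions can stand for one transformation.
  The two bijections are therefore joined up to agreement on sections, and the laws of
  \<open>Delta_Inf\<close> and \<open>Delta_Pre\<close> compare components on sections only. The two
  halves differ in what existence means. Over K, totality of a functional relation gives only a
  cover h \<le> Sup of its values, with no single witness valid on all of h; so morphisms are
  handled as matrices of truth values, and inf must distribute over Sup for them to compose. Over
  down-closed sets there is a witness at each stage h, so a relational-presheaf is handled as a
  partial equivalence relation at each stage and its points are chased as elements. Both halves are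
  Yoneda arguments: a section x of P at h names the point (h, x) of \<open>Delta_Inf P\<close>, of
  extent h, and a point a of F that is related to itself at h names a section of
  \<open>Theta_Pre F\<close> at h.\<close>

lemma inf_Sup_distrib:
  fixes x :: "'k::complete_heyting_algebra"
  shows "inf x (Sup A) = (SUP a\<in>A. inf x a)"
proof (rule antisym)
  obtain z where z: "\<And>w. w \<le> z \<longleftrightarrow> inf w x \<le> (SUP a\<in>A. inf x a)"
    using ex_relative_pseudocomplement by metis
  have "a \<le> z" if "a \<in> A" for a
    unfolding z inf.commute[of a x] using that by (rule SUP_upper)
  then have "Sup A \<le> z" by (rule Sup_least)
  then show "inf x (Sup A) \<le> (SUP a\<in>A. inf x a)"
    unfolding z by (simp add: inf.commute)
qed (auto intro!: SUP_least intro: le_infI2 Sup_upper)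

lemma inf_SUP_distrib:
  fixes x :: "'k::complete_heyting_algebra"
  shows "inf x (SUP a\<in>A. f a) = (SUP a\<in>A. inf x (f a))"
    and "inf (SUP a\<in>A. f a) x = (SUP a\<in>A. inf (f a) x)"
  by (simp_all add: inf_Sup_distrib image_comp inf.commute[of _ x])

text \<open>The entry \<open>v b a\<close> is the greatest stage at which the pair is related.
  Entries off the carriers leave no trace, so equality of such families is equality of entries on A
  and B only.\<close>

definition fam :: "'a set \<Rightarrow> 'b set \<Rightarrow> ('b \<Rightarrow> 'a \<Rightarrow> 'k::order) \<Rightarrow> ('k, 'a, 'b) relfam" where
  "fam A B v = \<lparr> src = A, tgt = B, rel = (\<lambda>h. {(b, a). b \<in> B \<and> a \<in> A \<and> h \<le> v b a}) \<rparr>"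

lemma src_fam [simp]: "src (fam A B v) = A"
  and tgt_fam [simp]: "tgt (fam A B v) = B"
  by (simp_all add: fam_def)

lemma rel_fam: "(b, a) \<in> rel (fam A B v) h \<longleftrightarrow> b \<in> B \<and> a \<in> A \<and> h \<le> v b a"
  by (simp add: fam_def)

lemma relfam_eqI:
  fixes \<sigma> \<tau> :: "('k, 'a, 'b) relfam"
  assumes "src \<sigma> = src \<tau>" "tgt \<sigma> = tgt \<tau>" "\<And>h b a. (b, a) \<in> rel \<sigma> h \<longleftrightarrow> (b, a) \<in> rel \<tau> h"
  shows "\<sigma> = \<tau>"
proof -
  have "rel \<sigma> = rel \<tau>" using assms(3) by (intro ext set_eqI) auto
  then show ?thesis using assms by (cases \<sigma>, cases \<tau>) simp
qed

lemma fam_eq_iff: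
  "fam A B u = fam A' B' v \<longleftrightarrow> A = A' \<and> B = B' \<and> (\<forall>a\<in>A. \<forall>b\<in>B. u b a = v b a)"
proof
  assume eq: "fam A B u = fam A' B' v"
  then have "src (fam A B u) = src (fam A' B' v)" "tgt (fam A B u) = tgt (fam A' B' v)" by simp_all
  moreover have "u b a = v b a" if "a \<in> A" "b \<in> B" for a b
  proof -
    have "\<And>h. (b, a) \<in> rel (fam A B u) h \<longleftrightarrow> (b, a) \<in> rel (fam A' B' v) h" using eq by simp
    with that calculation have "\<And>h. h \<le> u b a \<longleftrightarrow> h \<le> v b a" by (simp add: rel_fam)
    then show ?thesis by (meson order.antisym order_refl)
  qed
  ultimately show "A = A' \<and> B = B' \<and> (\<forall>a\<in>A. \<forall>b\<in>B. u b a = v b a)" by auto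
qed (auto intro!: relfam_eqI simp: rel_fam)

lemma infima_preserving_fam: "infima_preserving (fam A B v)"
  by (auto simp: infima_preserving_def relation_family_def principal_down_closed_def fam_def)

lemma infima_preservingE:
  assumes "infima_preserving \<tau>"
  obtains v where "\<tau> = fam (src \<tau>) (tgt \<tau>) v"
proof -
  have "\<forall>b a. \<exists>h. a \<in> src \<tau> \<longrightarrow> b \<in> tgt \<tau> \<longrightarrow> {h. (b, a) \<in> rel \<tau> h} = {k. k \<le> h}"
    using assms by (auto simp: infima_preserving_def principal_down_closed_def)
  then obtain v where
    v: "\<And>b a. a \<in> src \<tau> \<Longrightarrow> b \<in> tgt \<tau> \<Longrightarrow> {h. (b, a) \<in> rel \<tau> h} = {k. k \<le> v b a}"
    by metis
  have "(b, a) \<in> rel \<tau> h \<longleftrightarrow> b \<in> tgt \<tau> \<and> a \<in> src \<tau> \<and> h \<le> v b a" for b a h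
    using assms v[of a b] by (auto simp: infima_preserving_def relation_family_def)
  then show ?thesis by (intro that[of v] relfam_eqI) (auto simp: rel_fam)
qed

lemma fam_conv_fam [simp]: "fam_conv (fam A B v) = fam B A (\<lambda>a b. v b a)"
  by (auto simp: fam_conv_def fam_def)

lemma fam_le_fam: "fam_le (fam A B u) (fam A B v) \<longleftrightarrow> (\<forall>a\<in>A. \<forall>b\<in>B. u b a \<le> v b a)"
  unfolding fam_le_def fam_def by (auto intro: order_trans)

text \<open>Composition is the matrix product for Sup and inf. Any admissible pair (k, l) passes
  through some b and so lies below the term of that b; conversely, the terms themselves form an
  admissible family. For empty B both sides have entry \<open>bot\<close>, which is why the empty
  family of pairs must be allowed.\<close>

lemma inf_comp_fam [simp]:
  fixes u :: "'c \<Rightarrow> 'b \<Rightarrow> 'k::complete_heyting_algebra"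
  shows "inf_comp (fam B C u) (fam A B v) = fam A C (\<lambda>c a. SUP b\<in>B. inf (u c b) (v b a))"
proof (intro relfam_eqI)
  fix h c a
  show "(c, a) \<in> rel (inf_comp (fam B C u) (fam A B v)) h \<longleftrightarrow>
    (c, a) \<in> rel (fam A C (\<lambda>c a. SUP b\<in>B. inf (u c b) (v b a))) h" (is "?L \<longleftrightarrow> ?R")
  proof
    assume ?L
    then obtain P where "c \<in> C" "a \<in> A" and h: "h \<le> Sup {inf k l | k l. (k, l) \<in> P}"
      and P: "\<And>k l. (k, l) \<in> P \<Longrightarrow> (c, a) \<in> rel (fam B C u) k O rel (fam A B v) l"
      by (fastforce simp: inf_comp_def)
    have "inf k l \<le> (SUP b\<in>B. inf (u c b) (v b a))" if kl: "(k, l) \<in> P" for k l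
    proof -
      obtain b where "b \<in> B" "k \<le> u c b" "l \<le> v b a" using P[OF kl] by (auto simp: rel_fam)
      then show ?thesis by (meson SUP_upper2 inf_mono)
    qed
    then have "Sup {inf k l | k l. (k, l) \<in> P} \<le> (SUP b\<in>B. inf (u c b) (v b a))"
      by (auto intro!: Sup_least)
    with h \<open>c \<in> C\<close> \<open>a \<in> A\<close> show ?R by (auto simp: rel_fam)
  next
    assume R: ?R
    \<comment> \<open>For each intermediate b, the largest stages at which it is related to c and to
      a.\<close>
    let ?P = "(\<lambda>b. (u c b, v b a)) ` B"
    have "{inf k l | k l. (k, l) \<in> ?P} = (\<lambda>b. inf (u c b) (v b a)) ` B" by auto
    moreover have "\<forall>(k, l)\<in>?P. (c, a) \<in> rel (fam B C u) k O rel (fam A B v) l"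
      using R by (auto simp: rel_fam)
    ultimately show ?L using R
      by (auto simp: rel_fam inf_comp_def intro!: exI[of _ ?P])
  qed
qed (simp_all add: inf_comp_def)

text \<open>These are the Heyting-valued sets of Higgs and of Fourman and Scott:
  \<open>e a b\<close> is the extent to which a and b are equal, and \<open>e a a\<close> is the
  extent to which a exists.\<close>

definition hset :: "'a set \<Rightarrow> ('a \<Rightarrow> 'a \<Rightarrow> 'k::complete_lattice) \<Rightarrow> bool" where
  "hset A e \<longleftrightarrow> (\<forall>a\<in>A. \<forall>b\<in>A. e a b = e b a) \<and>
     (\<forall>a\<in>A. \<forall>b\<in>A. \<forall>c\<in>A. inf (e a b) (e b c) \<le> e a c)"

text \<open>The clauses are, in order: strictness, extensionality in the source, extensionality in
  the target, single-valuedness, totality. They are the morphism equations of \<open>hom_Inf\<close>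
  written as inequalities between entries.\<close>

definition hmap :: "'a set \<Rightarrow> ('a \<Rightarrow> 'a \<Rightarrow> 'k::complete_lattice) \<Rightarrow> 'b set \<Rightarrow> ('b \<Rightarrow> 'b \<Rightarrow> 'k) \<Rightarrow>
    ('b \<Rightarrow> 'a \<Rightarrow> 'k) \<Rightarrow> bool" where
  "hmap A e B g v \<longleftrightarrow>
     (\<forall>a\<in>A. \<forall>b\<in>B. v b a \<le> e a a) \<and>
     (\<forall>a\<in>A. \<forall>a'\<in>A. \<forall>b\<in>B. inf (v b a) (e a a') \<le> v b a') \<and>
     (\<forall>a\<in>A. \<forall>b\<in>B. \<forall>b'\<in>B. inf (g b' b) (v b a) \<le> v b' a) \<and>
     (\<forall>a\<in>A. \<forall>b\<in>B. \<forall>b'\<in>B. inf (v b a) (v b' a) \<le> g b b') \<and>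
     (\<forall>a\<in>A. e a a \<le> (SUP b\<in>B. v b a))"

lemma hset_sym: "hset A e \<Longrightarrow> a \<in> A \<Longrightarrow> b \<in> A \<Longrightarrow> e a b = e b a"
  by (simp add: hset_def)

lemma hset_trans:
  "hset A e \<Longrightarrow> a \<in> A \<Longrightarrow> b \<in> A \<Longrightarrow> c \<in> A \<Longrightarrow> inf (e a b) (e b c) \<le> e a c"
  by (simp add: hset_def)

lemma hset_le_refl: "hset A e \<Longrightarrow> a \<in> A \<Longrightarrow> b \<in> A \<Longrightarrow> e a b \<le> e a a"
  using hset_trans[of A e a b a] by (simp add: hset_sym[of A e b a])

lemma hmapD:
  assumes "hmap A e B g v" "a \<in> A" "b \<in> B"
  shows "v b a \<le> e a a"
    and "a' \<in> A \<Longrightarrow> inf (v b a) (e a a') \<le> v b a'"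
    and "b' \<in> B \<Longrightarrow> inf (g b' b) (v b a) \<le> v b' a"
    and "b' \<in> B \<Longrightarrow> inf (v b a) (v b' a) \<le> g b b'"
  using assms by (auto simp: hmap_def)

lemma hmap_total: "hmap A e B g v \<Longrightarrow> a \<in> A \<Longrightarrow> e a a \<le> (SUP b\<in>B. v b a)"
  by (simp add: hmap_def)

text \<open>One half of FF = F is transitivity. For the other half the supremum is bounded below by
  its term at b = c, using that \<open>e c a\<close> is at most the extent of c.\<close>

lemma rel_sheaf_fam:
  fixes e :: "'a \<Rightarrow> 'a \<Rightarrow> 'k::complete_heyting_algebra"
  shows "rel_sheaf (fam A A e) \<longleftrightarrow> hset A e"
proof -
  have "(\<forall>a\<in>A. \<forall>c\<in>A. (SUP b\<in>A. inf (e c b) (e b a)) = e c a) \<longleftrightarrow>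
      (\<forall>a\<in>A. \<forall>b\<in>A. \<forall>c\<in>A. inf (e a b) (e b c) \<le> e a c)" (is "?L \<longleftrightarrow> ?R")
    if sym: "\<forall>a\<in>A. \<forall>b\<in>A. e b a = e a b"
  proof
    assume L: ?L
    show ?R
    proof (intro ballI)
      fix a b c assume *: "a \<in> A" "b \<in> A" "c \<in> A"
      have "inf (e a b) (e b c) \<le> (SUP b\<in>A. inf (e a b) (e b c))"
        using *(2) by (rule SUP_upper)
      then show "inf (e a b) (e b c) \<le> e a c" using L * by simp
    qed
  next
    assume R: ?R
    have h: "hset A e" using R sym by (auto simp: hset_def)
    show ?L
    proof (intro ballI antisym)
      fix a c assume ac: "a \<in> A" "c \<in> A"
      show "(SUP b\<in>A. inf (e c b) (e b a)) \<le> e c a" using R ac by (auto intro!: SUP_least)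
      show "e c a \<le> (SUP b\<in>A. inf (e c b) (e b a))"
        using ac hset_le_refl[OF h ac(2,1)] by (intro SUP_upper2[of c]) auto
    qed
  qed
  then show ?thesis
    by (auto simp: rel_sheaf_def infima_preserving_fam fam_eq_iff hset_def)
qed

lemma rel_sheafE:
  fixes F :: "('k::complete_heyting_algebra, 'a, 'a) relfam"
  assumes "rel_sheaf F"
  obtains A e where "F = fam A A e" "hset A e"
proof -
  obtain v where "F = fam (src F) (tgt F) v" "src F = tgt F"
    using assms infima_preservingE by (metis rel_sheaf_def)
  with assms that show ?thesis by (metis rel_sheaf_fam)
qed

text \<open>The upper bound is extensionality. The lower bound is the term at a' = a, where
  strictness makes \<open>e a a\<close> absorb into the meet.\<close>

lemma SUP_comp_hmap_eq:
  fixes e :: "'a \<Rightarrow> 'a \<Rightarrow> 'k::complete_heyting_algebra"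
  assumes "hset A e" "hmap A e B g v" "a \<in> A" "b \<in> B"
  shows "(SUP a'\<in>A. inf (v b a') (e a' a)) = v b a"
proof (rule antisym)
  show "v b a \<le> (SUP a'\<in>A. inf (v b a') (e a' a))"
    using assms hmapD(1)[OF assms(2-4)] by (intro SUP_upper2[of a]) auto
qed (use assms hmapD(2) in \<open>auto intro!: SUP_least\<close>)

text \<open>The lower bound is the term at b' = b: single-valuedness for two equal values says that
  \<open>v b a\<close> is at most \<open>g b b\<close>.\<close>

lemma SUP_eq_comp_hmap:
  fixes e :: "'a \<Rightarrow> 'a \<Rightarrow> 'k::complete_heyting_algebra"
  assumes "hmap A e B g v" "a \<in> A" "b \<in> B"
  shows "(SUP b'\<in>B. inf (g b b') (v b' a)) = v b a"
proof (rule antisym)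
  show "v b a \<le> (SUP b'\<in>B. inf (g b b') (v b' a))"
    using assms hmapD(4)[OF assms assms(3)] by (intro SUP_upper2[of b]) auto
qed (use assms hmapD(3) in \<open>auto intro!: SUP_least\<close>)

lemma hom_Inf_fam:
  fixes e :: "'a \<Rightarrow> 'a \<Rightarrow> 'k::complete_heyting_algebra"
  assumes "hset A e" "hset B g"
  shows "fam A B v \<in> hom_Inf (fam A A e) (fam B B g) \<longleftrightarrow> hmap A e B g v"
proof
  assume "fam A B v \<in> hom_Inf (fam A A e) (fam B B g)"
  then have 1: "\<And>a b. a \<in> A \<Longrightarrow> b \<in> B \<Longrightarrow> (SUP a'\<in>A. inf (v b a') (e a' a)) = v b a"
    and 2: "\<And>a b. a \<in> A \<Longrightarrow> b \<in> B \<Longrightarrow> (SUP b'\<in>B. inf (g b b') (v b' a)) = v b a"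
    and 3: "\<And>a a'. a \<in> A \<Longrightarrow> a' \<in> A \<Longrightarrow> e a a' \<le> (SUP b\<in>B. inf (v b a) (v b a'))"
    and 4: "\<And>b b'. b \<in> B \<Longrightarrow> b' \<in> B \<Longrightarrow> (SUP a\<in>A. inf (v b a) (v b' a)) \<le> g b b'"
    by (auto simp: hom_Inf_def fam_eq_iff fam_le_fam)
  \<comment> \<open>Strictness comes from the identity law: each term of the product with e at
    column a is bounded by some \<open>e a' a\<close>, hence by the extent of a.\<close>
  have "v b a \<le> e a a" if "a \<in> A" "b \<in> B" for a b
  proof -
    have "e a' a \<le> e a a" if "a' \<in> A" for a'
      using hset_le_refl[OF assms(1) \<open>a \<in> A\<close> that] hset_sym[OF assms(1) \<open>a \<in> A\<close> that] by simp
    then have "(SUP a'\<in>A. inf (v b a') (e a' a)) \<le> e a a"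
      by (auto intro!: SUP_least le_infI2)
    then show ?thesis using 1[OF that] by simp
  qed
  moreover have "inf (v b a) (e a a') \<le> v b a'" if "a \<in> A" "a' \<in> A" "b \<in> B" for a a' b
    using SUP_upper[of a A "\<lambda>a. inf (v b a) (e a a')"] 1[OF that(2,3)] that(1) by simp
  moreover have "inf (g b' b) (v b a) \<le> v b' a" if "a \<in> A" "b \<in> B" "b' \<in> B" for a b b'
    using SUP_upper[of b B "\<lambda>b. inf (g b' b) (v b a)"] 2[OF that(1,3)] that(2) by simp
  moreover have "inf (v b a) (v b' a) \<le> g b b'" if "a \<in> A" "b \<in> B" "b' \<in> B" for a b b'
    using 4[OF that(2,3)] that(1) by (simp add: SUP_le_iff)
  moreover have "e a a \<le> (SUP b\<in>B. v b a)" if "a \<in> A" for a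
    using 3[OF that that] by simp
  ultimately show "hmap A e B g v" by (auto simp: hmap_def)
next
  assume h: "hmap A e B g v"
  \<comment> \<open>\<open>hmap\<close> states totality on the diagonal only. Off the diagonal,
    cover the extent of a by its values and transport each of them along
    \<open>e a a'\<close>.\<close>
  have "e a a' \<le> (SUP b\<in>B. inf (v b a) (v b a'))" if a: "a \<in> A" "a' \<in> A" for a a'
  proof -
    have "e a a' \<le> inf (SUP b\<in>B. v b a) (e a a')"
      using hset_le_refl[OF assms(1) a] hmap_total[OF h a(1)] by auto
    also have "\<dots> \<le> (SUP b\<in>B. inf (v b a) (v b a'))"
      unfolding inf_SUP_distrib using hmapD(2)[OF h a(1) _ a(2)] by (intro SUP_subset_mono) auto
    finally show ?thesis .
  qed
  with h show "fam A B v \<in> hom_Inf (fam A A e) (fam B B g)"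
    using SUP_comp_hmap_eq[OF assms(1) h] SUP_eq_comp_hmap[OF h] hmapD(4)[OF h]
    by (auto simp: hom_Inf_def fam_eq_iff fam_le_fam infima_preserving_fam intro!: SUP_least)
qed

lemma hom_InfE:
  fixes e :: "'a \<Rightarrow> 'a \<Rightarrow> 'k::complete_heyting_algebra"
  assumes "\<theta> \<in> hom_Inf (fam A A e) (fam B B g)" "hset A e" "hset B g"
  obtains v where "\<theta> = fam A B v" "hmap A e B g v"
proof -
  obtain v where "\<theta> = fam (src \<theta>) (tgt \<theta>) v" "src \<theta> = A" "tgt \<theta> = B"
    using assms(1) infima_preservingE by (auto simp: hom_Inf_def)
  with assms that show ?thesis by (metis hom_Inf_fam)
qed

text \<open>By distributivity both sides expand to a double supremum of the same triple meets, and
  the two suprema commute.\<close>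

lemma inf_comp_assoc:
  fixes \<rho> :: "('k::complete_heyting_algebra, 'c, 'd) relfam"
  assumes "infima_preserving \<rho>" "infima_preserving \<sigma>" "infima_preserving \<tau>"
    and "src \<rho> = tgt \<sigma>" "src \<sigma> = tgt \<tau>"
  shows "inf_comp \<rho> (inf_comp \<sigma> \<tau>) = inf_comp (inf_comp \<rho> \<sigma>) \<tau>"
proof -
  obtain A B C D u v w where [simp]: "\<rho> = fam C D u" "\<sigma> = fam B C v" "\<tau> = fam A B w"
    using assms infima_preservingE by metis
  have "(SUP c\<in>C. inf (u d c) (SUP b\<in>B. inf (v c b) (w b a))) =
      (SUP b\<in>B. inf (SUP c\<in>C. inf (u d c) (v c b)) (w b a))" for d a
    unfolding inf_SUP_distrib inf.assoc by (rule SUP_commute)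
  then show ?thesis by simp
qed

lemma hmap_comp:
  fixes e :: "'a \<Rightarrow> 'a \<Rightarrow> 'k::complete_heyting_algebra"
  assumes v: "hmap A e B g v" and u: "hmap B g C d u"
  shows "hmap A e C d (\<lambda>c a. SUP b\<in>B. inf (u c b) (v b a))"
  unfolding hmap_def inf_SUP_distrib
proof (intro conjI ballI SUP_least)
  fix a c b assume *: "a \<in> A" "c \<in> C" "b \<in> B"
  show "inf (u c b) (v b a) \<le> e a a" using hmapD(1)[OF v] * by (auto intro: le_infI2)
next
  fix a a' c b assume *: "a \<in> A" "a' \<in> A" "c \<in> C" "b \<in> B"
  have "inf (inf (u c b) (v b a)) (e a a') \<le> inf (u c b) (v b a')"
    using hmapD(2)[OF v, of a b a'] * by (metis inf.assoc inf_mono order_refl)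
  then show "inf (inf (u c b) (v b a)) (e a a') \<le> (SUP b\<in>B. inf (u c b) (v b a'))"
    using * by (auto intro: SUP_upper2)
next
  fix a c c' b assume *: "a \<in> A" "c \<in> C" "c' \<in> C" "b \<in> B"
  have "inf (d c' c) (inf (u c b) (v b a)) \<le> inf (u c' b) (v b a)"
    using hmapD(3)[OF u, of b c c'] * by (metis inf.assoc inf_mono order_refl)
  then show "inf (d c' c) (inf (u c b) (v b a)) \<le> (SUP b\<in>B. inf (u c' b) (v b a))"
    using * by (auto intro: SUP_upper2)
next
  \<comment> \<open>The two values may pass through different intermediates b and b'.
    Single-valuedness of v makes these equal to the extent \<open>g b b'\<close>, u is moved from b
    to b' along it, and then single-valuedness of u applies.\<close>
  fix a c c' b b' assume *: "a \<in> A" "c \<in> C" "c' \<in> C" "b' \<in> B" "b \<in> B"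
  have "inf (inf (u c b) (v b a)) (inf (u c' b') (v b' a)) \<le>
      inf (inf (u c b) (inf (v b a) (v b' a))) (u c' b')"
    by (simp add: inf.assoc inf.left_commute inf.commute)
  also have "\<dots> \<le> inf (inf (u c b) (g b b')) (u c' b')"
    using hmapD(4)[OF v, of a b b'] * by (metis inf_mono order_refl)
  also have "\<dots> \<le> inf (u c b') (u c' b')"
    using hmapD(2)[OF u, of b c b'] * by (metis inf_mono order_refl)
  also have "\<dots> \<le> d c c'" using hmapD(4)[OF u] * by auto
  finally show "inf (inf (u c b) (v b a)) (inf (u c' b') (v b' a)) \<le> d c c'" .
next
  fix a assume a: "a \<in> A"
  \<comment> \<open>A value b of a exists at least to the extent \<open>v b a\<close>, so totality
    of u at b covers that extent.\<close>
  have "v b a \<le> (SUP c\<in>C. inf (u c b) (v b a))" if b: "b \<in> B" for b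
  proof -
    have "v b a \<le> g b b" using hmapD(4)[OF v a b b] by simp
    also have "\<dots> \<le> (SUP c\<in>C. u c b)" using hmap_total[OF u b] .
    finally show ?thesis unfolding inf_SUP_distrib(2)[symmetric] by simp
  qed
  then have "(SUP b\<in>B. v b a) \<le> (SUP b\<in>B. SUP c\<in>C. inf (u c b) (v b a))"
    by (intro SUP_mono) auto
  with hmap_total[OF v a] show "e a a \<le> (SUP c\<in>C. SUP b\<in>B. inf (u c b) (v b a))"
    by (subst SUP_commute) (rule order_trans)
qed

section \<open>The category of relational-sheaves\<close>

lemma hom_Inf_comp:
  fixes F :: "('k::complete_heyting_algebra, 'a, 'a) relfam"
  assumes "rel_sheaf F" "rel_sheaf G" "rel_sheaf H" "\<tau> \<in> hom_Inf F G" "\<sigma> \<in> hom_Inf G H"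
  shows "inf_comp \<sigma> \<tau> \<in> hom_Inf F H"
proof -
  obtain A e B g C d where 1: "F = fam A A e" "G = fam B B g" "H = fam C C d"
    "hset A e" "hset B g" "hset C d"
    using assms rel_sheafE by metis
  moreover obtain v where "\<tau> = fam A B v" "hmap A e B g v"
    using 1 assms(4) by (auto elim: hom_InfE)
  moreover obtain u where "\<sigma> = fam B C u" "hmap B g C d u"
    using 1 assms(5) by (auto elim: hom_InfE)
  ultimately show ?thesis by (simp add: hom_Inf_fam hmap_comp)
qed

lemma hom_Inf_ident:
  fixes F :: "('k::complete_heyting_algebra, 'a, 'a) relfam"
  assumes "rel_sheaf F"
  shows "F \<in> hom_Inf F F"
  using assms by (auto simp: rel_sheaf_def hom_Inf_def fam_le_def)

lemma hom_Inf_assoc: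
  fixes \<rho> :: "('k::complete_heyting_algebra, 'c, 'd) relfam"
  assumes "\<tau> \<in> hom_Inf F G" "\<sigma> \<in> hom_Inf G H" "\<rho> \<in> hom_Inf H K"
    and "rel_sheaf G" "rel_sheaf H"
  shows "inf_comp \<rho> (inf_comp \<sigma> \<tau>) = inf_comp (inf_comp \<rho> \<sigma>) \<tau>"
  using assms by (intro inf_comp_assoc) (auto simp: hom_Inf_def rel_sheaf_def)

lemma category_Rel_Inf:
  "category (Rel_Inf :: (('k::complete_heyting_algebra, 'a, 'a) relfam, _) cat)"
  unfolding category_def
proof (intro conjI ballI)
  fix W X Y Z :: "('k, 'a, 'a) relfam" and f g h
  assume "W \<in> Obj Rel_Inf" "X \<in> Obj Rel_Inf" "Y \<in> Obj Rel_Inf" "Z \<in> Obj Rel_Inf"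
    "f \<in> Hom Rel_Inf W X" "g \<in> Hom Rel_Inf X Y" "h \<in> Hom Rel_Inf Y Z"
  then show "Comp Rel_Inf h (Comp Rel_Inf g f) = Comp Rel_Inf (Comp Rel_Inf h g) f"
    by (auto simp: Rel_Inf_def intro: hom_Inf_assoc)
qed (auto simp: Rel_Inf_def hom_Inf_ident hom_Inf_comp, auto simp: hom_Inf_def)


section \<open>The functors between presheaves and relational-sheaves\<close>

definition presheaf :: "('k::order, 'x) psh \<Rightarrow> bool" where
  "presheaf P \<longleftrightarrow>
     (\<forall>h k. \<forall>x\<in>sec P h. k \<le> h \<longrightarrow> res P h k x \<in> sec P k) \<and>
     (\<forall>h. \<forall>x\<in>sec P h. res P h h x = x) \<and>
     (\<forall>h k l. \<forall>x\<in>sec P h. l \<le> k \<longrightarrow> k \<le> h \<longrightarrow> res P k l (res P h k x) = res P h l x)"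

definition nat_trans :: "('k::order, 'x) psh \<Rightarrow> ('k, 'y) psh \<Rightarrow> ('k \<Rightarrow> 'x \<Rightarrow> 'y) \<Rightarrow> bool" where
  "nat_trans P Q s \<longleftrightarrow>
     (\<forall>h. \<forall>x\<in>sec P h. s h x \<in> sec Q h) \<and>
     (\<forall>h k. \<forall>x\<in>sec P h. k \<le> h \<longrightarrow> s k (res P h k x) = res Q h k (s h x))"

lemma presheafD:
  assumes "presheaf P" "x \<in> sec P h"
  shows "k \<le> h \<Longrightarrow> res P h k x \<in> sec P k"
    and "res P h h x = x"
    and "l \<le> k \<Longrightarrow> k \<le> h \<Longrightarrow> res P k l (res P h k x) = res P h l x"
  using assms by (auto simp: presheaf_def)

lemma nat_transD:
  assumes "nat_trans P Q s" "x \<in> sec P h"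
  shows "s h x \<in> sec Q h"
    and "k \<le> h \<Longrightarrow> s k (res P h k x) = res Q h k (s h x)"
  using assms by (auto simp: nat_trans_def)

section \<open>Morphisms out of singleton sheaves\<close>

lemma singleton_sheaf_eq_fam: "singleton_sheaf h = fam {()} {()} (\<lambda>_ _. h)"
  by (rule relfam_eqI) (auto simp: singleton_sheaf_def fam_def)

lemma singleton_map_eq_fam: "singleton_map k h = fam {()} {()} (\<lambda>_ _. k)"
  by (rule relfam_eqI) (auto simp: singleton_map_def fam_def)

lemma hset_const: "hset {()} (\<lambda>_ _. h)"
  by (simp add: hset_def)

lemma rel_sheaf_singleton: "rel_sheaf (singleton_sheaf (h::'k::complete_heyting_algebra))"
  by (simp add: singleton_sheaf_eq_fam rel_sheaf_fam hset_const)

text \<open>A singleton, in the sense of Heyting-valued sets, of extent h: a would-be element of B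
  given by the extent to which it equals each b. The two bounds together force the supremum of x to
  be exactly h.\<close>

definition singleton_elt :: "'b set \<Rightarrow> ('b \<Rightarrow> 'b \<Rightarrow> 'k::complete_lattice) \<Rightarrow> 'k \<Rightarrow> ('b \<Rightarrow> 'k) \<Rightarrow> bool"
  where "singleton_elt B g h x \<longleftrightarrow> (\<forall>b\<in>B. x b \<le> h) \<and>
     (\<forall>b\<in>B. \<forall>b'\<in>B. inf (g b' b) (x b) \<le> x b') \<and>
     (\<forall>b\<in>B. \<forall>b'\<in>B. inf (x b) (x b') \<le> g b b') \<and> h \<le> (SUP b\<in>B. x b)"

lemma hmap_const_iff:
  "hmap {()} (\<lambda>_ _. h) B g v \<longleftrightarrow> singleton_elt B g h (\<lambda>b. v b ())"
  unfolding hmap_def singleton_elt_def by (auto intro: le_infI1)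

definition row :: "'b set \<Rightarrow> ('b \<Rightarrow> 'k::order) \<Rightarrow> ('k, unit, 'b) relfam" where
  "row B x = fam {()} B (\<lambda>b _. x b)"

lemma row_eq_iff: "row B x = row B y \<longleftrightarrow> (\<forall>b\<in>B. x b = y b)"
  by (simp add: row_def fam_eq_iff)

lemma row_in_hom_Inf:
  fixes g :: "'b \<Rightarrow> 'b \<Rightarrow> 'k::complete_heyting_algebra"
  assumes "hset B g"
  shows "row B x \<in> hom_Inf (singleton_sheaf h) (fam B B g) \<longleftrightarrow> singleton_elt B g h x"
  unfolding row_def singleton_sheaf_eq_fam
  using assms by (simp add: hom_Inf_fam hset_const hmap_const_iff)

lemma hom_Inf_singletonE:
  fixes g :: "'b \<Rightarrow> 'b \<Rightarrow> 'k::complete_heyting_algebra"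
  assumes "\<alpha> \<in> hom_Inf (singleton_sheaf h) (fam B B g)" "hset B g"
  obtains x where "\<alpha> = row B x" "singleton_elt B g h x"
proof -
  obtain v where "\<alpha> = fam {()} B v" "hmap {()} (\<lambda>_ _. h) B g v"
    using assms hom_InfE[OF _ hset_const] unfolding singleton_sheaf_eq_fam by metis
  moreover then have "\<alpha> = row B (\<lambda>b. v b ())" by (auto simp: row_def fam_eq_iff)
  ultimately show ?thesis using that[of "\<lambda>b. v b ()"] by (simp add: hmap_const_iff)
qed

lemma comp_row:
  fixes v :: "'c \<Rightarrow> 'b \<Rightarrow> 'k::complete_heyting_algebra"
  shows "inf_comp (fam B C v) (row B x) = row C (\<lambda>c. SUP b\<in>B. inf (v c b) (x b))"
  by (simp add: row_def)

lemma row_comp_singleton_map: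
  fixes x :: "'b \<Rightarrow> 'k::complete_heyting_algebra"
  shows "inf_comp (row B x) (singleton_map k h) = row B (\<lambda>b. inf (x b) k)"
  by (simp add: row_def singleton_map_eq_fam)

text \<open>Totality survives because, by distributivity, the supremum of the cut entries is the
  meet of k with the old supremum.\<close>

lemma singleton_elt_restrict:
  fixes g :: "'b \<Rightarrow> 'b \<Rightarrow> 'k::complete_heyting_algebra"
  assumes "singleton_elt B g h x" "k \<le> h"
  shows "singleton_elt B g k (\<lambda>b. inf (x b) k)"
proof -
  have "inf (g b' b) (inf (x b) k) \<le> inf (x b') k" if "b \<in> B" "b' \<in> B" for b b'
    using assms that unfolding singleton_elt_def
    by (metis inf.assoc inf.cobounded2 inf_mono order_refl)
  moreover have "inf (inf (x b) k) (inf (x b') k) \<le> g b b'" if "b \<in> B" "b' \<in> B" for b b'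
    using assms that unfolding singleton_elt_def
    by (meson inf.cobounded1 inf_mono order_trans)
  moreover have "k \<le> (SUP b\<in>B. x b)"
    using assms order_trans unfolding singleton_elt_def by blast
  ultimately show ?thesis
    unfolding singleton_elt_def inf_SUP_distrib(2)[symmetric] by simp
qed

lemma sec_Theta_Inf [simp]: "sec (on_obj Theta_Inf G) h = hom_Inf (singleton_sheaf h) G"
  by (simp add: Theta_Inf_def)

lemma res_Theta_Inf [simp]: "res (on_obj Theta_Inf G) h k \<alpha> = inf_comp \<alpha> (singleton_map k h)"
  by (simp add: Theta_Inf_def)

lemma mor_Theta_Inf [simp]: "on_mor Theta_Inf G G' \<tau> h \<alpha> = inf_comp \<tau> \<alpha>"
  by (simp add: Theta_Inf_def)

lemma presheaf_Theta_Inf: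
  fixes G :: "('k::complete_heyting_algebra, 'b, 'b) relfam"
  assumes "rel_sheaf G"
  shows "presheaf (on_obj Theta_Inf G)"
proof -
  obtain B g where G: "G = fam B B g" "hset B g" using assms by (rule rel_sheafE)
  show ?thesis
    unfolding presheaf_def
  proof (intro conjI allI ballI impI)
    fix h k \<alpha> assume "\<alpha> \<in> sec (on_obj Theta_Inf G) h" "k \<le> h"
    then show "res (on_obj Theta_Inf G) h k \<alpha> \<in> sec (on_obj Theta_Inf G) k"
      using G by (auto elim!: hom_Inf_singletonE
        simp: row_comp_singleton_map row_in_hom_Inf singleton_elt_restrict)
  next
    fix h \<alpha> assume "\<alpha> \<in> sec (on_obj Theta_Inf G) h"
    then show "res (on_obj Theta_Inf G) h h \<alpha> = \<alpha>"
      using G by (auto elim!: hom_Inf_singletonE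
        simp: row_comp_singleton_map row_eq_iff singleton_elt_def inf_absorb1)
  next
    fix h k l \<alpha> assume "\<alpha> \<in> sec (on_obj Theta_Inf G) h" "l \<le> k" "k \<le> h"
    then show "res (on_obj Theta_Inf G) k l (res (on_obj Theta_Inf G) h k \<alpha>) =
        res (on_obj Theta_Inf G) h l \<alpha>"
      using G by (auto elim!: hom_Inf_singletonE
        simp: row_comp_singleton_map row_eq_iff inf.assoc inf_absorb2)
  qed
qed

text \<open>Restriction composes on the right and \<tau> on the left, so naturality is associativity
  of composition.\<close>

lemma nat_trans_Theta_Inf:
  fixes G :: "('k::complete_heyting_algebra, 'b, 'b) relfam"
  assumes "rel_sheaf G" "rel_sheaf G'" "\<tau> \<in> hom_Inf G G'"
  shows "nat_trans (on_obj Theta_Inf G) (on_obj Theta_Inf G') (on_mor Theta_Inf G G' \<tau>)"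
proof -
  have "inf_comp \<tau> (inf_comp \<alpha> (singleton_map k h)) = inf_comp (inf_comp \<tau> \<alpha>) (singleton_map k h)"
    if "\<alpha> \<in> hom_Inf (singleton_sheaf h) G" for \<alpha> k h
    using assms that
    by (intro inf_comp_assoc)
      (auto simp: hom_Inf_def rel_sheaf_def singleton_sheaf_def singleton_map_eq_fam infima_preserving_fam)
  then show ?thesis
    using assms by (auto simp: nat_trans_def intro: hom_Inf_comp rel_sheaf_singleton)
qed

section \<open>Sections of a presheaf as a Heyting-valued set\<close>

definition psh_eq :: "('k::complete_lattice, 'x) psh \<Rightarrow> 'k \<times> 'x \<Rightarrow> 'k \<times> 'x \<Rightarrow> 'k" where
  "psh_eq P b a = Sup {m. m \<le> inf (fst a) (fst b) \<and> res P (fst b) m (snd b) = res P (fst a) m (snd a)}"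

text \<open>The function on points induced by s. In \<open>mor_Delta_Inf\<close> the matrix of s is
  equality with \<open>graph s a\<close>, that is, the functional relation represented by this
  function.\<close>

definition graph :: "('k \<Rightarrow> 'x \<Rightarrow> 'y) \<Rightarrow> 'k \<times> 'x \<Rightarrow> 'k \<times> 'y" where
  "graph s p = (fst p, s (fst p) (snd p))"

lemma coproduct_iff [simp]: "p \<in> coproduct P \<longleftrightarrow> snd p \<in> sec P (fst p)"
  by (cases p) (simp add: coproduct_def)

lemma obj_Delta_Inf: "on_obj Delta_Inf P = fam (coproduct P) (coproduct P) (psh_eq P)"
  by (auto simp: Delta_Inf_def fam_def psh_eq_def)

lemma mor_Delta_Inf:
  "on_mor Delta_Inf P Q s = fam (coproduct P) (coproduct Q) (\<lambda>b a. psh_eq Q b (graph s a))"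
  by (auto simp: Delta_Inf_def fam_def psh_eq_def graph_def)

text \<open>For a general presheaf two sections need not agree at the stage
  \<open>psh_eq P b a\<close> itself, which is only a supremum of stages of agreement. Bounds are
  therefore tested at each such stage, and distributivity carries the meet with c inside.\<close>

lemma psh_eq_inf_le_iff:
  fixes P :: "('k::complete_heyting_algebra, 'x) psh"
  shows "inf c (psh_eq P b a) \<le> d \<longleftrightarrow> (\<forall>m. m \<le> fst a \<longrightarrow> m \<le> fst b \<longrightarrow>
    res P (fst b) m (snd b) = res P (fst a) m (snd a) \<longrightarrow> inf c m \<le> d)"
  unfolding psh_eq_def inf_Sup_distrib by (auto simp: SUP_le_iff)

lemma psh_eq_le_iff:
  fixes P :: "('k::complete_heyting_algebra, 'x) psh"
  shows "psh_eq P b a \<le> d \<longleftrightarrow> (\<forall>m. m \<le> fst a \<longrightarrow> m \<le> fst b \<longrightarrow>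
    res P (fst b) m (snd b) = res P (fst a) m (snd a) \<longrightarrow> m \<le> d)"
  unfolding psh_eq_def by (auto simp: Sup_le_iff)

lemma le_psh_eq:
  "m \<le> fst a \<Longrightarrow> m \<le> fst b \<Longrightarrow> res P (fst b) m (snd b) = res P (fst a) m (snd a) \<Longrightarrow>
    m \<le> psh_eq P b a"
  unfolding psh_eq_def by (auto intro: Sup_upper)

lemma psh_eq_sym: "psh_eq P b a = psh_eq P a b"
  unfolding psh_eq_def by (simp add: inf.commute eq_commute)

lemma psh_eq_refl: "psh_eq P a a = fst a"
  by (rule antisym) (auto simp: psh_eq_def intro: Sup_least Sup_upper)

lemma psh_eq_le: "psh_eq P b a \<le> fst a" "psh_eq P b a \<le> fst b"
  unfolding psh_eq_def by (auto intro: Sup_least)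

text \<open>If b and c agree at m, and a and b agree at n, then all three agree at
  \<open>inf m n\<close>.\<close>

lemma hset_psh_eq:
  fixes P :: "('k::complete_heyting_algebra, 'x) psh"
  assumes P: "presheaf P"
  shows "hset (coproduct P) (psh_eq P)"
proof -
  have "inf (psh_eq P a b) (psh_eq P b c) \<le> psh_eq P a c"
    if "a \<in> coproduct P" "b \<in> coproduct P" "c \<in> coproduct P" for a b c
    \<comment> \<open>The first use opens the right factor of the meet; after commuting, the second
      opens the left one.\<close>
    unfolding psh_eq_inf_le_iff unfolding inf.commute[of "psh_eq P a b"] psh_eq_inf_le_iff
  proof (intro allI impI)
    fix m n assume m: "m \<le> fst c" "m \<le> fst b"
      "res P (fst b) m (snd b) = res P (fst c) m (snd c)" and n: "n \<le> fst b" "n \<le> fst a"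
      "res P (fst a) n (snd a) = res P (fst b) n (snd b)"
    have "res P (fst a) (inf m n) (snd a) = res P (fst b) (inf m n) (snd b)"
      using n that presheafD(3)[OF P, of _ _ "inf m n" n] by (metis coproduct_iff inf.cobounded2)
    also have "\<dots> = res P (fst c) (inf m n) (snd c)"
      using m that presheafD(3)[OF P, of _ _ "inf m n" m] by (metis coproduct_iff inf.cobounded1)
    finally show "inf m n \<le> psh_eq P a c"
      using m n by (intro le_psh_eq) (auto intro: le_infI1 le_infI2)
  qed
  then show ?thesis unfolding hset_def using psh_eq_sym by auto
qed

lemma rel_sheaf_Delta_Inf:
  "presheaf (P :: ('k::complete_heyting_algebra, 'x) psh) \<Longrightarrow> rel_sheaf (on_obj Delta_Inf P)"
  by (simp add: obj_Delta_Inf rel_sheaf_fam hset_psh_eq)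

lemma psh_eq_graph_le:
  fixes P :: "('k::complete_heyting_algebra, 'x) psh"
  assumes "nat_trans P Q s" "a \<in> coproduct P" "b \<in> coproduct P"
  shows "psh_eq P b a \<le> psh_eq Q (graph s b) (graph s a)"
  unfolding psh_eq_le_iff
proof (intro allI impI)
  fix m assume "m \<le> fst a" "m \<le> fst b" "res P (fst b) m (snd b) = res P (fst a) m (snd a)"
  with assms show "m \<le> psh_eq Q (graph s b) (graph s a)"
    by (intro le_psh_eq) (simp_all add: graph_def, metis nat_transD(2))
qed

lemma graph_in_coproduct: "nat_trans P Q s \<Longrightarrow> a \<in> coproduct P \<Longrightarrow> graph s a \<in> coproduct Q"
  by (simp add: graph_def nat_transD)

lemma hmap_graph:
  fixes P :: "('k::complete_heyting_algebra, 'x) psh"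
  assumes Q: "presheaf Q" and s: "nat_trans P Q s"
  shows "hmap (coproduct P) (psh_eq P) (coproduct Q) (psh_eq Q) (\<lambda>b a. psh_eq Q b (graph s a))"
proof -
  note g = graph_in_coproduct[OF s]
  note tr = hset_trans[OF hset_psh_eq[OF Q]]
  show ?thesis
    unfolding hmap_def
  proof (intro conjI ballI)
    fix a b assume "a \<in> coproduct P" "b \<in> coproduct Q"
    show "psh_eq Q b (graph s a) \<le> psh_eq P a a"
      using psh_eq_le(1)[of Q b "graph s a"] by (simp add: psh_eq_refl graph_def)
  next
    fix a a' b assume *: "a \<in> coproduct P" "a' \<in> coproduct P" "b \<in> coproduct Q"
    have "inf (psh_eq Q b (graph s a)) (psh_eq P a a') \<le>
        inf (psh_eq Q b (graph s a)) (psh_eq Q (graph s a) (graph s a'))"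
      using psh_eq_graph_le[OF s *(2,1)] by (intro inf_mono) auto
    also have "\<dots> \<le> psh_eq Q b (graph s a')" using tr[OF *(3) g[OF *(1)] g[OF *(2)]] .
    finally show "inf (psh_eq Q b (graph s a)) (psh_eq P a a') \<le> psh_eq Q b (graph s a')" .
  next
    fix a b b' assume *: "a \<in> coproduct P" "b \<in> coproduct Q" "b' \<in> coproduct Q"
    show "inf (psh_eq Q b' b) (psh_eq Q b (graph s a)) \<le> psh_eq Q b' (graph s a)"
      using tr[OF *(3,2) g[OF *(1)]] .
    show "inf (psh_eq Q b (graph s a)) (psh_eq Q b' (graph s a)) \<le> psh_eq Q b b'"
      using tr[OF *(2) g[OF *(1)] *(3)] by (simp add: psh_eq_sym[of Q b'])
  next
    fix a assume a: "a \<in> coproduct P"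
    show "psh_eq P a a \<le> (SUP b\<in>coproduct Q. psh_eq Q b (graph s a))"
      \<comment> \<open>The value is the image point itself, which has the same stage, hence the
        same extent, as a.\<close>
      using g[OF a] by (intro SUP_upper2[of "graph s a"]) (simp_all add: psh_eq_refl, simp add: graph_def)
  qed
qed

lemma hom_Delta_Inf:
  fixes P :: "('k::complete_heyting_algebra, 'x) psh"
  assumes "presheaf P" "presheaf Q" "nat_trans P Q s"
  shows "on_mor Delta_Inf P Q s \<in> hom_Inf (on_obj Delta_Inf P) (on_obj Delta_Inf Q)"
  using assms by (simp add: obj_Delta_Inf mor_Delta_Inf hom_Inf_fam hset_psh_eq hmap_graph)

text \<open>Precomposing with a represented relation is substitution: extensionality of v collapses
  the product over Q to its value at \<open>graph s a\<close>.\<close>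

lemma Delta_Inf_comp_graph:
  fixes v :: "'c \<Rightarrow> 'k \<times> 'y \<Rightarrow> 'k::complete_heyting_algebra"
  assumes "presheaf Q" "nat_trans P Q s" "hmap (coproduct Q) (psh_eq Q) C d v"
  shows "inf_comp (fam (coproduct Q) C v) (on_mor Delta_Inf P Q s) =
    fam (coproduct P) C (\<lambda>c a. v c (graph s a))"
  unfolding mor_Delta_Inf inf_comp_fam fam_eq_iff
  using SUP_comp_hmap_eq[OF hset_psh_eq[OF assms(1)] assms(3)] graph_in_coproduct[OF assms(2)]
  by blast

text \<open>The transformation r is compared with the composite on sections only, because the
  associativity that identifies them in the applications is available only for morphisms out of
  singleton sheaves.\<close>

lemma Delta_Inf_comp:
  fixes P :: "('k::complete_heyting_algebra, 'x) psh"
  assumes "presheaf P" "presheaf Q" "presheaf R" "nat_trans P Q s" "nat_trans Q R t"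
    and "\<And>h x. x \<in> sec P h \<Longrightarrow> r h x = t h (s h x)"
  shows "on_mor Delta_Inf P R r = inf_comp (on_mor Delta_Inf Q R t) (on_mor Delta_Inf P Q s)"
  unfolding mor_Delta_Inf[of Q R] Delta_Inf_comp_graph[OF assms(2,4) hmap_graph[OF assms(3,5)]]
  using assms(6) by (auto simp: mor_Delta_Inf fam_eq_iff graph_def)

lemma Delta_Inf_ident:
  assumes "\<And>h x. x \<in> sec P h \<Longrightarrow> s h x = x"
  shows "on_mor Delta_Inf P P s = on_obj Delta_Inf P"
  using assms by (auto simp: mor_Delta_Inf obj_Delta_Inf fam_eq_iff graph_def)


section \<open>The adjunction between presheaves and relational-sheaves\<close>

text \<open>The column of t at the point (h, x), that is, t composed with the morphism from the
  singleton sheaf at h named by x. It is read off the relations directly, so it depends on no choice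
  of a matrix for t.\<close>

definition rows :: "('k::order, 'k \<times> 'x, 'b) relfam \<Rightarrow> 'k \<Rightarrow> 'x \<Rightarrow> ('k, unit, 'b) relfam" where
  "rows t h x = \<lparr> src = {()}, tgt = tgt t, rel = (\<lambda>k. {(b, u). (b, (h, x)) \<in> rel t k}) \<rparr>"

lemma rows_fam: "(h, x) \<in> C \<Longrightarrow> rows (fam C B v) h x = row B (\<lambda>b. v b (h, x))"
  by (rule relfam_eqI) (auto simp: rows_def row_def fam_def)

text \<open>The points (h, x) and its restriction to k are equal to extent at least k, so
  extensionality transports values both ways; strictness at the restricted point supplies the bound
  by k. This is the naturality of \<open>rows\<close>.\<close>

lemma hmap_psh_res:
  fixes P :: "('k::complete_heyting_algebra, 'x) psh"
  assumes P: "presheaf P" and v: "hmap (coproduct P) (psh_eq P) B g v"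
    and x: "x \<in> sec P h" "k \<le> h" "b \<in> B"
  shows "v b (k, res P h k x) = inf (v b (h, x)) k"
proof (rule antisym)
  have y: "(h, x) \<in> coproduct P" "(k, res P h k x) \<in> coproduct P"
    using x presheafD[OF P x(1)] by auto
  \<comment> \<open>The stage k itself is a stage of agreement, since restricting twice to k changes
    nothing.\<close>
  have k: "k \<le> psh_eq P (h, x) (k, res P h k x)"
    using x presheafD[OF P x(1)] presheafD(2)[OF P, of "res P h k x"] by (intro le_psh_eq) auto
  then show "inf (v b (h, x)) k \<le> v b (k, res P h k x)"
    using hmapD(2)[OF v y(1) x(3) y(2)] by (meson inf_mono order_refl order_trans)
  have "v b (k, res P h k x) \<le> k" using hmapD(1)[OF v y(2) x(3)] by (simp add: psh_eq_refl)
  moreover from this k have "v b (k, res P h k x) \<le> v b (h, x)"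
    using hmapD(2)[OF v y(2) x(3) y(1)] psh_eq_sym[of P "(h, x)"]
    by (metis inf.absorb1 order_trans)
  ultimately show "v b (k, res P h k x) \<le> inf (v b (h, x)) k" by simp
qed

text \<open>A point (h, x) has extent h, so the clauses of \<open>hmap\<close> at that point become
  those of \<open>singleton_elt\<close>.\<close>

lemma nat_trans_rows:
  fixes P :: "('k::complete_heyting_algebra, 'x) psh"
  assumes P: "presheaf P" and G: "rel_sheaf G" and t: "t \<in> hom_Inf (on_obj Delta_Inf P) G"
  shows "nat_trans P (on_obj Theta_Inf G) (rows t)"
proof -
  obtain B g where G: "G = fam B B g" "hset B g" using G by (rule rel_sheafE)
  obtain v where v: "t = fam (coproduct P) B v" "hmap (coproduct P) (psh_eq P) B g v"
    using t hset_psh_eq[OF P] G unfolding obj_Delta_Inf by (auto elim: hom_InfE)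
  have "singleton_elt B g h (\<lambda>b. v b (h, x))" if "x \<in> sec P h" for h x
    using v(2) that unfolding hmap_def singleton_elt_def
    by (metis coproduct_iff fst_conv snd_conv psh_eq_refl)
  then show ?thesis
    using v G hmap_psh_res[OF P v(2)] presheafD[OF P]
    by (auto simp: nat_trans_def rows_fam row_in_hom_Inf row_comp_singleton_map row_eq_iff)
qed

text \<open>The prescribed rows are assembled into one matrix. Its clauses within one column are
  those of \<open>singleton_elt\<close>; extensionality between columns is what naturality of s
  provides.\<close>

lemma ex_hom_rows_eq:
  fixes P :: "('k::complete_heyting_algebra, 'x) psh"
  assumes P: "presheaf P" and G: "rel_sheaf G" and s: "nat_trans P (on_obj Theta_Inf G) s"
  shows "\<exists>t\<in>hom_Inf (on_obj Delta_Inf P) G. \<forall>h. \<forall>x\<in>sec P h. rows t h x = s h x"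
proof -
  obtain B g where G: "G = fam B B g" "hset B g" using G by (rule rel_sheafE)
  have "\<exists>y. s h x = row B y \<and> singleton_elt B g h y" if "x \<in> sec P h" for h x
    using nat_transD(1)[OF s that] G by (auto elim: hom_Inf_singletonE)
  then have "\<forall>h x. \<exists>y. x \<in> sec P h \<longrightarrow> s h x = row B y \<and> singleton_elt B g h y" by blast
  then obtain y where y: "\<And>h x. x \<in> sec P h \<Longrightarrow> s h x = row B (y h x)"
    "\<And>h x. x \<in> sec P h \<Longrightarrow> singleton_elt B g h (y h x)"
    by metis
  have res: "y k (res P h k x) b = inf (y h x b) k" if "x \<in> sec P h" "k \<le> h" "b \<in> B" for h k x b
    using nat_transD(2)[OF s that(1,2)] y(1) that presheafD(1)[OF P that(1,2)]
    by (simp add: row_comp_singleton_map row_eq_iff)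
  let ?v = "\<lambda>b p. y (fst p) (snd p) b"
  have "hmap (coproduct P) (psh_eq P) B g ?v"
    unfolding hmap_def psh_eq_inf_le_iff
  proof (intro conjI ballI allI impI)
    fix p q b m assume *: "p \<in> coproduct P" "q \<in> coproduct P" "b \<in> B" "m \<le> fst q" "m \<le> fst p"
      "res P (fst p) m (snd p) = res P (fst q) m (snd q)"
    \<comment> \<open>At a stage m of agreement the two points have a common restriction, and both
      sides are its entry at b.\<close>
    then have "inf (?v b p) m = inf (?v b q) m" using res by (metis coproduct_iff)
    then show "inf (?v b p) m \<le> ?v b q" by simp
  qed (use y(2) in \<open>auto simp: singleton_elt_def psh_eq_refl\<close>)
  then have "fam (coproduct P) B ?v \<in> hom_Inf (on_obj Delta_Inf P) G"
    using G hset_psh_eq[OF P] by (simp add: obj_Delta_Inf hom_Inf_fam)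
  then show ?thesis by (rule bexI[rotated]) (auto simp: rows_fam y(1))
qed

text \<open>A morphism relates only points of its carriers, so it has no pairs outside the columns
  at sections.\<close>

lemma rows_inject:
  fixes P :: "('k::complete_heyting_algebra, 'x) psh"
  assumes "t \<in> hom_Inf (on_obj Delta_Inf P) G" "t' \<in> hom_Inf (on_obj Delta_Inf P) G"
    and eq: "\<And>h x. x \<in> sec P h \<Longrightarrow> rows t h x = rows t' h x"
  shows "t = t'"
proof (rule relfam_eqI)
  fix k b and p :: "'k \<times> 'x"
  have *: "(b, p) \<in> rel u k \<Longrightarrow> snd p \<in> sec P (fst p)"
    if "u \<in> hom_Inf (on_obj Delta_Inf P) G" for u
    using that unfolding hom_Inf_def infima_preserving_def relation_family_def obj_Delta_Inf
    by fastforce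
  have "(b, p) \<in> rel t k \<longleftrightarrow> (b, p) \<in> rel t' k" if "snd p \<in> sec P (fst p)"
  proof -
    have "(b, ()) \<in> rel (rows t (fst p) (snd p)) k \<longleftrightarrow> (b, ()) \<in> rel (rows t' (fst p) (snd p)) k"
      using eq[OF that] by simp
    then show ?thesis by (simp add: rows_def)
  qed
  with *[OF assms(1)] *[OF assms(2)] show "(b, p) \<in> rel t k \<longleftrightarrow> (b, p) \<in> rel t' k" by blast
qed (use assms in \<open>auto simp: hom_Inf_def\<close>)

text \<open>Precomposition with \<open>Delta_Inf\<close> of n is substitution, so it only selects
  the column at \<open>n h x\<close>; composing with g on the left acts column by column.\<close>

lemma rows_natural:
  fixes P :: "('k::complete_heyting_algebra, 'x) psh"
  assumes P: "presheaf P" "presheaf P'" and G: "rel_sheaf G" "rel_sheaf G'"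
    and n: "nat_trans P' P n" and t: "t \<in> hom_Inf (on_obj Delta_Inf P) G"
    and g: "g \<in> hom_Inf G G'" and x: "x \<in> sec P' h"
  shows "rows (inf_comp g (inf_comp t (on_mor Delta_Inf P' P n))) h x =
    inf_comp g (rows t h (n h x))"
proof -
  obtain B e where B: "G = fam B B e" "hset B e" using G(1) by (rule rel_sheafE)
  obtain B' e' where B': "G' = fam B' B' e'" "hset B' e'" using G(2) by (rule rel_sheafE)
  obtain v where v: "t = fam (coproduct P) B v" "hmap (coproduct P) (psh_eq P) B e v"
    using t hset_psh_eq[OF P(1)] B unfolding obj_Delta_Inf by (auto elim: hom_InfE)
  obtain w where w: "g = fam B B' w" using g B B' by (auto elim: hom_InfE)
  have "n h x \<in> sec P h" using nat_transD(1)[OF n x] .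
  then show ?thesis
    unfolding v(1) w Delta_Inf_comp_graph[OF P(1) n v(2)] inf_comp_fam
    using x by (simp add: rows_fam comp_row graph_def)
qed


section \<open>Relational-presheaves\<close>

lemma order_preservingD:
  assumes "order_preserving \<tau>" "(b, a) \<in> rel \<tau> h"
  shows "a \<in> src \<tau>" "b \<in> tgt \<tau>" "k \<le> h \<Longrightarrow> (b, a) \<in> rel \<tau> k"
  using assms unfolding order_preserving_def relation_family_def down_closed_def by blast+

lemma order_preservingI:
  assumes "\<And>h b a. (b, a) \<in> rel \<tau> h \<Longrightarrow> a \<in> src \<tau> \<and> b \<in> tgt \<tau>"
    and "\<And>h k b a. (b, a) \<in> rel \<tau> h \<Longrightarrow> k \<le> h \<Longrightarrow> (b, a) \<in> rel \<tau> k"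
  shows "order_preserving \<tau>"
  using assms unfolding order_preserving_def relation_family_def down_closed_def by auto

text \<open>Both k and l may be lowered to h by down-closure, so composition is ordinary relational
  composition at each stage.\<close>

lemma rel_ord_comp:
  assumes "order_preserving \<sigma>" "order_preserving \<tau>"
  shows "(c, a) \<in> rel (ord_comp \<sigma> \<tau>) h \<longleftrightarrow> (\<exists>b. (c, b) \<in> rel \<sigma> h \<and> (b, a) \<in> rel \<tau> h)"
proof
  assume "(c, a) \<in> rel (ord_comp \<sigma> \<tau>) h"
  then show "\<exists>b. (c, b) \<in> rel \<sigma> h \<and> (b, a) \<in> rel \<tau> h"
    using order_preservingD(3)[OF assms(1)] order_preservingD(3)[OF assms(2)]
    by (fastforce simp: ord_comp_def)
next
  assume "\<exists>b. (c, b) \<in> rel \<sigma> h \<and> (b, a) \<in> rel \<tau> h"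
  then show "(c, a) \<in> rel (ord_comp \<sigma> \<tau>) h"
    using order_preservingD[OF assms(1)] order_preservingD[OF assms(2)]
    by (auto simp: ord_comp_def intro!: exI[of _ h])
qed

lemma src_ord_comp [simp]: "src (ord_comp \<sigma> \<tau>) = src \<tau>"
  and tgt_ord_comp [simp]: "tgt (ord_comp \<sigma> \<tau>) = tgt \<sigma>"
  by (simp_all add: ord_comp_def)

lemma order_preserving_ord_comp:
  assumes "order_preserving \<sigma>" "order_preserving \<tau>"
  shows "order_preserving (ord_comp \<sigma> \<tau>)"
proof (rule order_preservingI)
  fix h k c a assume "(c, a) \<in> rel (ord_comp \<sigma> \<tau>) h"
  then obtain b where b: "(c, b) \<in> rel \<sigma> h" "(b, a) \<in> rel \<tau> h"
    unfolding rel_ord_comp[OF assms] by blast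
  then show "a \<in> src (ord_comp \<sigma> \<tau>) \<and> c \<in> tgt (ord_comp \<sigma> \<tau>)"
    using order_preservingD(1)[OF assms(2)] order_preservingD(2)[OF assms(1)] by simp
  assume "k \<le> h"
  with b show "(c, a) \<in> rel (ord_comp \<sigma> \<tau>) k"
    unfolding rel_ord_comp[OF assms]
    using order_preservingD(3)[OF assms(1)] order_preservingD(3)[OF assms(2)] by blast
qed

section \<open>Relational-presheaves and their morphisms at a fixed stage\<close>

lemma relfam_eq_iff:
  "\<sigma> = \<tau> \<longleftrightarrow> src \<sigma> = src \<tau> \<and> tgt \<sigma> = tgt \<tau> \<and> (\<forall>h b a. (b, a) \<in> rel \<sigma> h \<longleftrightarrow> (b, a) \<in> rel \<tau> h)"
  for \<sigma> \<tau> :: "('k, 'a, 'b) relfam"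
  by (auto intro: relfam_eqI)

lemma src_fam_conv [simp]: "src (fam_conv \<tau>) = tgt \<tau>"
  and tgt_fam_conv [simp]: "tgt (fam_conv \<tau>) = src \<tau>"
  and rel_fam_conv [simp]: "(a, b) \<in> rel (fam_conv \<tau>) h \<longleftrightarrow> (b, a) \<in> rel \<tau> h"
  by (simp_all add: fam_conv_def)

lemma order_preserving_fam_conv: "order_preserving \<tau> \<Longrightarrow> order_preserving (fam_conv \<tau>)"
  by (rule order_preservingI) (auto dest: order_preservingD)

text \<open>At each stage F is a partial equivalence relation. The half of FF = F other than
  transitivity holds because an element related to anything is related to itself.\<close>

lemma rel_presheaf_iff:
  "rel_presheaf F \<longleftrightarrow> src F = tgt F \<and> order_preserving F \<and>
    (\<forall>h a b. (a, b) \<in> rel F h \<longrightarrow> (b, a) \<in> rel F h) \<and>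
    (\<forall>h a b c. (a, b) \<in> rel F h \<longrightarrow> (b, c) \<in> rel F h \<longrightarrow> (a, c) \<in> rel F h)"
proof (cases "src F = tgt F \<and> order_preserving F")
  case True
  then have F: "src F = tgt F" "order_preserving F" by auto
  have "fam_conv F = F \<longleftrightarrow> (\<forall>h a b. (a, b) \<in> rel F h \<longrightarrow> (b, a) \<in> rel F h)"
    unfolding relfam_eq_iff using F(1) by auto
  moreover have "ord_comp F F = F \<longleftrightarrow>
      (\<forall>h a c. (\<exists>b. (a, b) \<in> rel F h \<and> (b, c) \<in> rel F h) \<longleftrightarrow> (a, c) \<in> rel F h)"
    unfolding relfam_eq_iff rel_ord_comp[OF F(2) F(2)] using F(1) by simp
  ultimately show ?thesis unfolding rel_presheaf_def using True by meson
qed (simp add: rel_presheaf_def, blast)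

lemma rel_presheafD:
  assumes "rel_presheaf F"
  shows "src F = tgt F" "order_preserving F"
    and "(a, b) \<in> rel F h \<Longrightarrow> (b, a) \<in> rel F h"
    and "(a, b) \<in> rel F h \<Longrightarrow> (b, c) \<in> rel F h \<Longrightarrow> (a, c) \<in> rel F h"
    and "(a, b) \<in> rel F h \<Longrightarrow> (a, a) \<in> rel F h"
    and "(a, b) \<in> rel F h \<Longrightarrow> (b, b) \<in> rel F h"
  using assms unfolding rel_presheaf_iff by blast+

text \<open>The stagewise form of \<open>hmap\<close>, with its clauses in the same order; totality
  now provides an actual b at stage h instead of a cover.\<close>

lemma hom_Ord_iff:
  assumes "rel_presheaf F" "rel_presheaf G"
  shows "\<theta> \<in> hom_Ord F G \<longleftrightarrow> src \<theta> = src F \<and> tgt \<theta> = tgt G \<and> order_preserving \<theta> \<and>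
    (\<forall>h b a. (b, a) \<in> rel \<theta> h \<longrightarrow> (a, a) \<in> rel F h) \<and>
    (\<forall>h b a a'. (b, a) \<in> rel \<theta> h \<longrightarrow> (a, a') \<in> rel F h \<longrightarrow> (b, a') \<in> rel \<theta> h) \<and>
    (\<forall>h b b' a. (b', b) \<in> rel G h \<longrightarrow> (b, a) \<in> rel \<theta> h \<longrightarrow> (b', a) \<in> rel \<theta> h) \<and>
    (\<forall>h b b' a. (b, a) \<in> rel \<theta> h \<longrightarrow> (b', a) \<in> rel \<theta> h \<longrightarrow> (b, b') \<in> rel G h) \<and>
    (\<forall>h a. (a, a) \<in> rel F h \<longrightarrow> (\<exists>b. (b, a) \<in> rel \<theta> h))" (is "?L \<longleftrightarrow> ?R")
proof (cases "order_preserving \<theta>")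
  case True
  note F = rel_presheafD[OF assms(1)] and G = rel_presheafD[OF assms(2)]
  note c = rel_ord_comp[OF True F(2)] rel_ord_comp[OF G(2) True]
    rel_ord_comp[OF True order_preserving_fam_conv[OF True]]
    rel_ord_comp[OF order_preserving_fam_conv[OF True] True]
  have 1: "ord_comp \<theta> F = \<theta> \<longleftrightarrow>
      (\<forall>h b a. (\<exists>a'. (b, a') \<in> rel \<theta> h \<and> (a', a) \<in> rel F h) \<longleftrightarrow> (b, a) \<in> rel \<theta> h)"
    if "src \<theta> = src F"
    unfolding relfam_eq_iff c using that by simp
  have 2: "ord_comp G \<theta> = \<theta> \<longleftrightarrow>
      (\<forall>h b a. (\<exists>b'. (b, b') \<in> rel G h \<and> (b', a) \<in> rel \<theta> h) \<longleftrightarrow> (b, a) \<in> rel \<theta> h)"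
    if "tgt \<theta> = tgt G"
    unfolding relfam_eq_iff c using that by simp
  have 3: "fam_le F (ord_comp (fam_conv \<theta>) \<theta>) \<longleftrightarrow>
      (\<forall>h a a'. (a, a') \<in> rel F h \<longrightarrow> (\<exists>b. (b, a) \<in> rel \<theta> h \<and> (b, a') \<in> rel \<theta> h))"
    by (simp add: fam_le_def subset_iff c)
  have 4: "fam_le (ord_comp \<theta> (fam_conv \<theta>)) G \<longleftrightarrow>
      (\<forall>h b b'. (\<exists>a. (b, a) \<in> rel \<theta> h \<and> (b', a) \<in> rel \<theta> h) \<longrightarrow> (b, b') \<in> rel G h)"
    by (simp add: fam_le_def subset_iff c)
  show ?thesis
  proof
    assume L: ?L
    then have st: "src \<theta> = src F" "tgt \<theta> = tgt G" by (simp_all add: hom_Ord_def)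
    have l1: "\<And>h b a. (\<exists>a'. (b, a') \<in> rel \<theta> h \<and> (a', a) \<in> rel F h) \<longleftrightarrow> (b, a) \<in> rel \<theta> h"
      and l2: "\<And>h b a. (\<exists>b'. (b, b') \<in> rel G h \<and> (b', a) \<in> rel \<theta> h) \<longleftrightarrow> (b, a) \<in> rel \<theta> h"
      and l3: "\<And>h a a'. (a, a') \<in> rel F h \<Longrightarrow> \<exists>b. (b, a) \<in> rel \<theta> h \<and> (b, a') \<in> rel \<theta> h"
      and l4: "\<And>h b b' a. (b, a) \<in> rel \<theta> h \<Longrightarrow> (b', a) \<in> rel \<theta> h \<Longrightarrow> (b, b') \<in> rel G h"
      using L unfolding 1[OF st(1), symmetric] 2[OF st(2), symmetric] hom_Ord_def mem_Collect_eq 3 4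
      using 1[OF st(1)] 2[OF st(2)] by metis+
    have "\<forall>h b a. (b, a) \<in> rel \<theta> h \<longrightarrow> (a, a) \<in> rel F h"
      using l1 F(6) by metis
    moreover have "\<forall>h b a a'. (b, a) \<in> rel \<theta> h \<longrightarrow> (a, a') \<in> rel F h \<longrightarrow> (b, a') \<in> rel \<theta> h"
      using l1 by metis
    moreover have "\<forall>h b b' a. (b', b) \<in> rel G h \<longrightarrow> (b, a) \<in> rel \<theta> h \<longrightarrow> (b', a) \<in> rel \<theta> h"
      using l2 by metis
    moreover have "\<forall>h b b' a. (b, a) \<in> rel \<theta> h \<longrightarrow> (b', a) \<in> rel \<theta> h \<longrightarrow> (b, b') \<in> rel G h"
      using l4 by metis
    moreover have "\<forall>h a. (a, a) \<in> rel F h \<longrightarrow> (\<exists>b. (b, a) \<in> rel \<theta> h)"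
      using l3 by metis
    ultimately show ?R using st True by (intro conjI)
  next
    assume R: ?R
    then have st: "src \<theta> = src F" "tgt \<theta> = tgt G" by simp_all
    have r: "\<And>h b a. (b, a) \<in> rel \<theta> h \<Longrightarrow> (a, a) \<in> rel F h"
      "\<And>h b a a'. (b, a) \<in> rel \<theta> h \<Longrightarrow> (a, a') \<in> rel F h \<Longrightarrow> (b, a') \<in> rel \<theta> h"
      "\<And>h b b' a. (b', b) \<in> rel G h \<Longrightarrow> (b, a) \<in> rel \<theta> h \<Longrightarrow> (b', a) \<in> rel \<theta> h"
      "\<And>h b b' a. (b, a) \<in> rel \<theta> h \<Longrightarrow> (b', a) \<in> rel \<theta> h \<Longrightarrow> (b, b') \<in> rel G h"
      "\<And>h a. (a, a) \<in> rel F h \<Longrightarrow> \<exists>b. (b, a) \<in> rel \<theta> h"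
      using R by blast+
    \<comment> \<open>Totality is given on the diagonal only: choose a value of a and move it to a'
      by extensionality.\<close>
    have "\<exists>b. (b, a) \<in> rel \<theta> h \<and> (b, a') \<in> rel \<theta> h" if "(a, a') \<in> rel F h" for h a a'
      using r(5)[OF F(5)[OF that]] r(2)[OF _ that] by blast
    moreover have "ord_comp \<theta> F = \<theta>" unfolding 1[OF st(1)] using r(1,2) by blast
    moreover have "ord_comp G \<theta> = \<theta>" unfolding 2[OF st(2)] using r(3,4) by blast
    moreover have "fam_le (ord_comp \<theta> (fam_conv \<theta>)) G" unfolding 4 using r(4) by blast
    ultimately show ?L using st True by (simp add: hom_Ord_def 3)
  qed
qed (simp add: hom_Ord_def)

lemma hom_OrdD:
  assumes "\<theta> \<in> hom_Ord F G" "rel_presheaf F" "rel_presheaf G"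
  shows "src \<theta> = src F" "tgt \<theta> = tgt G" "order_preserving \<theta>"
    and "(b, a) \<in> rel \<theta> h \<Longrightarrow> (a, a) \<in> rel F h"
    and "(b, a) \<in> rel \<theta> h \<Longrightarrow> (a, a') \<in> rel F h \<Longrightarrow> (b, a') \<in> rel \<theta> h"
    and "(b', b) \<in> rel G h \<Longrightarrow> (b, a) \<in> rel \<theta> h \<Longrightarrow> (b', a) \<in> rel \<theta> h"
    and "(b, a) \<in> rel \<theta> h \<Longrightarrow> (b', a) \<in> rel \<theta> h \<Longrightarrow> (b, b') \<in> rel G h"
    and "(a, a) \<in> rel F h \<Longrightarrow> \<exists>b. (b, a) \<in> rel \<theta> h"
  using assms(1) unfolding hom_Ord_iff[OF assms(2,3)] by blast+

lemma hom_Ord_ident: "rel_presheaf F \<Longrightarrow> F \<in> hom_Ord F F"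
  unfolding hom_Ord_iff by (auto dest: rel_presheafD)

lemma hom_Ord_comp:
  assumes "rel_presheaf F" "rel_presheaf G" "rel_presheaf H" "\<tau> \<in> hom_Ord F G" "\<sigma> \<in> hom_Ord G H"
  shows "ord_comp \<sigma> \<tau> \<in> hom_Ord F H"
proof -
  note t = hom_OrdD[OF assms(4,1,2)] and s = hom_OrdD[OF assms(5,2,3)]
  show ?thesis
    unfolding hom_Ord_iff[OF assms(1,3)] rel_ord_comp[OF s(3) t(3)]
  proof (intro conjI allI impI)
    fix h a assume "(a, a) \<in> rel F h"
    then obtain b where b: "(b, a) \<in> rel \<tau> h" using t(8) by blast
    then have "(b, b) \<in> rel G h" using t(7) by blast
    then show "\<exists>c b. (c, b) \<in> rel \<sigma> h \<and> (b, a) \<in> rel \<tau> h" using s(8) b by blast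
  next
    fix h c c' a
    assume "\<exists>b. (c, b) \<in> rel \<sigma> h \<and> (b, a) \<in> rel \<tau> h" "\<exists>b. (c', b) \<in> rel \<sigma> h \<and> (b, a) \<in> rel \<tau> h"
    then show "(c, c') \<in> rel H h" using s(5,7) t(7) by meson
  next
    fix h c c' a assume "(c', c) \<in> rel H h" "\<exists>b. (c, b) \<in> rel \<sigma> h \<and> (b, a) \<in> rel \<tau> h"
    then show "\<exists>b. (c', b) \<in> rel \<sigma> h \<and> (b, a) \<in> rel \<tau> h" using s(6) by meson
  next
    fix h c a a' assume "\<exists>b. (c, b) \<in> rel \<sigma> h \<and> (b, a) \<in> rel \<tau> h" "(a, a') \<in> rel F h"
    then show "\<exists>b. (c, b) \<in> rel \<sigma> h \<and> (b, a') \<in> rel \<tau> h" using t(5) by meson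
  next
    fix h c a assume "\<exists>b. (c, b) \<in> rel \<sigma> h \<and> (b, a) \<in> rel \<tau> h"
    then show "(a, a) \<in> rel F h" using t(4) by meson
  qed (simp_all only: src_ord_comp tgt_ord_comp t(1) s(2) order_preserving_ord_comp[OF s(3) t(3)])
qed

lemma ord_comp_assoc:
  assumes "order_preserving \<rho>" "order_preserving \<sigma>" "order_preserving \<tau>"
  shows "ord_comp \<rho> (ord_comp \<sigma> \<tau>) = ord_comp (ord_comp \<rho> \<sigma>) \<tau>"
  by (rule relfam_eqI)
    (use assms in \<open>auto simp: rel_ord_comp order_preserving_ord_comp\<close>)

lemma category_Rel_Ord:
  "category (Rel_Ord :: (('k::complete_lattice, 'a, 'a) relfam, _) cat)"
  unfolding category_def
proof (intro conjI ballI)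
  fix W X Y Z :: "('k, 'a, 'a) relfam" and f g h
  assume "W \<in> Obj Rel_Ord" "X \<in> Obj Rel_Ord" "Y \<in> Obj Rel_Ord" "Z \<in> Obj Rel_Ord"
    "f \<in> Hom Rel_Ord W X" "g \<in> Hom Rel_Ord X Y" "h \<in> Hom Rel_Ord Y Z"
  then show "Comp Rel_Ord h (Comp Rel_Ord g f) = Comp Rel_Ord (Comp Rel_Ord h g) f"
    by (auto simp: Rel_Ord_def hom_Ord_def intro: ord_comp_assoc)
qed (auto simp: Rel_Ord_def hom_Ord_ident hom_Ord_comp, auto simp: hom_Ord_def)


section \<open>From relational-presheaves to relational-sheaves\<close>

lemma elems_principal [simp]: "elems (principal h) = {k. k \<le> h}"
  unfolding principal_def by (rule elems_Downset) (auto simp: down_closed_def)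

lemma principal_le_iff: "principal h \<le> A \<longleftrightarrow> h \<in> elems A"
  using down_closed_elems[of A] by (auto simp: less_eq_downset_def down_closed_def)

lemma principal_mono: "k \<le> h \<Longrightarrow> principal k \<le> principal h"
  by (simp add: principal_le_iff)

lemma downset_eq_iff: "A = B \<longleftrightarrow> (\<forall>h. h \<in> elems A \<longleftrightarrow> h \<in> elems B)"
  by (auto simp: elems_inject[symmetric])

lemma downset_le_iff: "A \<le> B \<longleftrightarrow> (\<forall>h. h \<in> elems A \<longrightarrow> h \<in> elems B)"
  by (auto simp: less_eq_downset_def)

text \<open>The matrix entry of \<open>Psi_fam \<tau>\<close>. For order-preserving \<tau> the set
  is down-closed, which is what makes \<open>Downset\<close> meaningful here.\<close>

definition holds :: "('h::order, 'a, 'b) relfam \<Rightarrow> 'b \<Rightarrow> 'a \<Rightarrow> 'h downset" where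
  "holds \<tau> b a = Downset {h. (b, a) \<in> rel \<tau> h}"

lemma elems_holds:
  assumes "order_preserving \<tau>"
  shows "elems (holds \<tau> b a) = {h. (b, a) \<in> rel \<tau> h}"
  unfolding holds_def using order_preservingD(3)[OF assms]
  by (intro elems_Downset) (auto simp: down_closed_def)

lemma Psi_fam_eq_fam:
  assumes "order_preserving \<tau>"
  shows "Psi_fam \<tau> = fam (src \<tau>) (tgt \<tau>) (holds \<tau>)"
  by (rule relfam_eqI) (auto simp: Psi_fam_def rel_fam downset_le_iff elems_holds[OF assms])

lemma hset_holds:
  fixes F :: "('h::complete_heyting_algebra, 'a, 'a) relfam"
  assumes "rel_presheaf F"
  shows "hset (src F) (holds F)"
  unfolding hset_def downset_eq_iff downset_le_iff elems_inf elems_holds[OF rel_presheafD(2)[OF assms]]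
  using rel_presheafD(3,4)[OF assms] by blast

text \<open>In the algebra of down-closed sets inf is intersection and Sup is union, so each clause
  of \<open>hmap\<close>, read at one element h, is a clause of \<open>hom_OrdD\<close>. For the
  union in totality the witness must also be placed in \<open>src G\<close>.\<close>

lemma hmap_holds:
  fixes F :: "('h::complete_heyting_algebra, 'a, 'a) relfam"
  assumes "rel_presheaf F" "rel_presheaf G" "\<theta> \<in> hom_Ord F G"
  shows "hmap (src F) (holds F) (src G) (holds G) (holds \<theta>)"
proof -
  note t = hom_OrdD[OF assms(3,1,2)]
  note e = elems_holds[OF rel_presheafD(2)[OF assms(1)]]
    elems_holds[OF rel_presheafD(2)[OF assms(2)]] elems_holds[OF t(3)]
  have total: "\<exists>b\<in>src G. (b, a) \<in> rel \<theta> h" if "(a, a) \<in> rel F h" for a h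
    using t(8)[OF that] order_preservingD(2)[OF t(3)] t(2) rel_presheafD(1)[OF assms(2)] by auto
  show ?thesis
    unfolding hmap_def downset_le_iff elems_inf elems_Sup image_image e Int_iff UN_iff mem_Collect_eq
    by (intro conjI ballI allI impI; (elim conjE)?;
        (erule t(4) | erule (1) t(5) | erule (1) t(6) | erule (1) t(7) | erule total))
qed

lemma Psi_fam_obj:
  "rel_presheaf F \<Longrightarrow> Psi_fam F = fam (src F) (src F) (holds F)"
  using Psi_fam_eq_fam rel_presheafD(1,2) by metis

lemma rel_sheaf_Psi_fam:
  "rel_presheaf (F :: ('h::complete_heyting_algebra, 'a, 'a) relfam) \<Longrightarrow> rel_sheaf (Psi_fam F)"
  by (simp add: Psi_fam_obj rel_sheaf_fam hset_holds)

lemma Psi_fam_hom: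
  "rel_presheaf F \<Longrightarrow> rel_presheaf G \<Longrightarrow> \<theta> \<in> hom_Ord F G \<Longrightarrow>
    Psi_fam \<theta> = fam (src F) (src G) (holds \<theta>)"
  using Psi_fam_eq_fam rel_presheafD(1) hom_OrdD(1,2,3) by metis

lemma hom_Inf_Psi_fam:
  fixes F :: "('h::complete_heyting_algebra, 'a, 'a) relfam"
  assumes "rel_presheaf F" "rel_presheaf G" "\<theta> \<in> hom_Ord F G"
  shows "Psi_fam \<theta> \<in> hom_Inf (Psi_fam F) (Psi_fam G)"
  using assms by (simp add: Psi_fam_obj Psi_fam_hom hom_Inf_fam hset_holds hmap_holds)

text \<open>The matrix product is a union of intersections, and h belongs to it exactly when some b
  links c and a at stage h.\<close>

lemma Psi_fam_comp:
  fixes F :: "('h::complete_heyting_algebra, 'a, 'a) relfam"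
  assumes "rel_presheaf F" "rel_presheaf G" "rel_presheaf H" "\<tau> \<in> hom_Ord F G" "\<sigma> \<in> hom_Ord G H"
  shows "Psi_fam (ord_comp \<sigma> \<tau>) = inf_comp (Psi_fam \<sigma>) (Psi_fam \<tau>)"
proof -
  note t = hom_OrdD[OF assms(4,1,2)] and s = hom_OrdD[OF assms(5,2,3)]
  note o = order_preserving_ord_comp[OF s(3) t(3)]
  have "holds (ord_comp \<sigma> \<tau>) c a = (SUP b\<in>src G. inf (holds \<sigma> c b) (holds \<tau> b a))" for c a
    unfolding downset_eq_iff elems_Sup image_image
    using order_preservingD(1)[OF s(3)] s(1)
    by (auto simp: elems_inf elems_holds[OF o] elems_holds[OF s(3)] elems_holds[OF t(3)]
        rel_ord_comp[OF s(3) t(3)])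
  then show ?thesis
    using assms by (simp add: Psi_fam_hom[OF assms(1,3) hom_Ord_comp[OF assms]] Psi_fam_hom fam_eq_iff)
qed

section \<open>The functor \<open>Theta_Pre\<close>\<close>

lemma sec_Lambda: "sec (on_obj Lambda P) h = sec P (principal h)"
  and res_Lambda: "res (on_obj Lambda P) h k = res P (principal h) (principal k)"
  and mor_Lambda: "on_mor Lambda P Q s h = s (principal h)"
  by (simp_all add: Lambda_def)

lemma presheaf_Lambda: "presheaf P \<Longrightarrow> presheaf (on_obj Lambda P)"
  by (simp add: presheaf_def sec_Lambda res_Lambda principal_mono)

lemma nat_trans_Lambda:
  "nat_trans P Q s \<Longrightarrow>
    nat_trans (on_obj Lambda P) (on_obj Lambda Q) (on_mor Lambda P Q s)"
  by (simp add: nat_trans_def sec_Lambda res_Lambda mor_Lambda principal_mono)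

lemma obj_Theta_Pre: "on_obj Theta_Pre F = on_obj Lambda (on_obj Theta_Inf (Psi_fam F))"
  and mor_Theta_Pre: "on_mor Theta_Pre F G \<theta> =
    on_mor Lambda (on_obj Theta_Inf (Psi_fam F)) (on_obj Theta_Inf (Psi_fam G))
      (on_mor Theta_Inf (Psi_fam F) (Psi_fam G) (Psi_fam \<theta>))"
  by (simp_all add: Theta_Pre_def func_comp_def Psi_def)

lemma sec_Theta_Pre:
  "sec (on_obj Theta_Pre F) h = hom_Inf (singleton_sheaf (principal h)) (Psi_fam F)"
  by (simp add: obj_Theta_Pre sec_Lambda)

lemma res_Theta_Pre:
  "res (on_obj Theta_Pre F) h k \<alpha> = inf_comp \<alpha> (singleton_map (principal k) (principal h))"
  by (simp add: obj_Theta_Pre res_Lambda)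

lemma mor_Theta_Pre_apply: "on_mor Theta_Pre F G \<theta> h \<alpha> = inf_comp (Psi_fam \<theta>) \<alpha>"
  by (simp add: mor_Theta_Pre mor_Lambda)

lemma presheaf_Theta_Pre: "rel_presheaf F \<Longrightarrow> presheaf (on_obj Theta_Pre F)"
  by (simp add: obj_Theta_Pre presheaf_Lambda presheaf_Theta_Inf rel_sheaf_Psi_fam)

lemma nat_trans_Theta_Pre:
  "rel_presheaf F \<Longrightarrow> rel_presheaf G \<Longrightarrow> \<theta> \<in> hom_Ord F G \<Longrightarrow>
    nat_trans (on_obj Theta_Pre F) (on_obj Theta_Pre G) (on_mor Theta_Pre F G \<theta>)"
  by (simp add: obj_Theta_Pre mor_Theta_Pre nat_trans_Lambda nat_trans_Theta_Inf
      rel_sheaf_Psi_fam hom_Inf_Psi_fam)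

section \<open>The left adjoint as a functor\<close>

lemma obj_a_Rel: "on_obj a_Rel F = on_obj Delta_Inf (on_obj Theta_Pre F)"
  and mor_a_Rel: "on_mor a_Rel F G \<theta> =
    on_mor Delta_Inf (on_obj Theta_Pre F) (on_obj Theta_Pre G) (on_mor Theta_Pre F G \<theta>)"
  by (simp_all add: a_Rel_def func_comp_def)

lemma is_functor_a_Rel:
  "is_functor Rel_Ord Rel_Inf
    (a_Rel :: (('h::complete_heyting_algebra, 'a, 'a) relfam, _, _, _) func)"
  unfolding is_functor_def
proof (intro conjI category_Rel_Inf category_Rel_Ord ballI)
  fix F :: "('h, 'a, 'a) relfam" assume "F \<in> Obj Rel_Ord"
  then have F: "rel_presheaf F" by (simp add: Rel_Ord_def)
  then show "on_obj a_Rel F \<in> Obj Rel_Inf"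
    by (simp add: Rel_Inf_def obj_a_Rel rel_sheaf_Delta_Inf presheaf_Theta_Pre)
  have "inf_comp (Psi_fam F) \<alpha> = \<alpha>" if "\<alpha> \<in> sec (on_obj Theta_Pre F) h" for h \<alpha>
    using that by (simp add: sec_Theta_Pre hom_Inf_def)
  then show "on_mor a_Rel F F (Ident Rel_Ord F) = Ident Rel_Inf (on_obj a_Rel F)"
    by (simp add: Rel_Ord_def Rel_Inf_def mor_a_Rel obj_a_Rel Delta_Inf_ident mor_Theta_Pre_apply)
next
  fix F G :: "('h, 'a, 'a) relfam" and f
  assume "F \<in> Obj Rel_Ord" "G \<in> Obj Rel_Ord" "f \<in> Hom Rel_Ord F G"
  then show "on_mor a_Rel F G f \<in> Hom Rel_Inf (on_obj a_Rel F) (on_obj a_Rel G)"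
    by (simp add: Rel_Ord_def Rel_Inf_def mor_a_Rel obj_a_Rel hom_Delta_Inf presheaf_Theta_Pre
        nat_trans_Theta_Pre)
next
  fix F G H :: "('h, 'a, 'a) relfam" and f g
  assume "F \<in> Obj Rel_Ord" "G \<in> Obj Rel_Ord" "H \<in> Obj Rel_Ord"
    "f \<in> Hom Rel_Ord F G" "g \<in> Hom Rel_Ord G H"
  then have *: "rel_presheaf F" "rel_presheaf G" "rel_presheaf H" "f \<in> hom_Ord F G"
    "g \<in> hom_Ord G H"
    by (simp_all add: Rel_Ord_def)
  have "inf_comp (Psi_fam (ord_comp g f)) \<alpha> = inf_comp (Psi_fam g) (inf_comp (Psi_fam f) \<alpha>)"
    if "\<alpha> \<in> sec (on_obj Theta_Pre F) h" for h \<alpha>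
    unfolding Psi_fam_comp[OF *]
    using that * by (intro hom_Inf_assoc[symmetric])
      (auto simp: sec_Theta_Pre intro!: hom_Inf_Psi_fam rel_sheaf_Psi_fam)
  then have "on_mor a_Rel F H (ord_comp g f) = inf_comp (on_mor a_Rel G H g) (on_mor a_Rel F G f)"
    unfolding mor_a_Rel using *
    by (intro Delta_Inf_comp) (auto simp: presheaf_Theta_Pre nat_trans_Theta_Pre mor_Theta_Pre_apply)
  then show "on_mor a_Rel F H (Comp Rel_Ord g f) =
      Comp Rel_Inf (on_mor a_Rel G H g) (on_mor a_Rel F G f)"
    by (simp add: Rel_Ord_def Rel_Inf_def)
qed


section \<open>From presheaves to relational-presheaves\<close>

abbreviation coprod_Gamma :: "('h::complete_heyting_algebra, 'x) psh \<Rightarrow> ('h downset \<times> ('h \<Rightarrow> 'x)) set"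
  where "coprod_Gamma Q \<equiv> coproduct (on_obj Gamma Q)"

lemma coprod_Gamma_iff: "p \<in> coprod_Gamma Q \<longleftrightarrow> snd p \<in> matching_families (elems (fst p)) Q"
  by (simp add: Gamma_def)

text \<open>For k \<le> h the meet in the matching condition is k, so on a down-closed index set
  matching means that values at smaller stages are restrictions of values at larger ones.\<close>

lemma coprod_GammaD:
  assumes "p \<in> coprod_Gamma Q" "h \<in> elems (fst p)"
  shows "snd p h \<in> sec Q h"
    and "presheaf Q \<Longrightarrow> k \<le> h \<Longrightarrow> k \<in> elems (fst p)"
    and "presheaf Q \<Longrightarrow> k \<le> h \<Longrightarrow> snd p k = res Q h k (snd p h)"
proof -
  have m: "snd p \<in> matching_families (elems (fst p)) Q" using assms(1) coprod_Gamma_iff by blast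
  then show "snd p h \<in> sec Q h" using assms(2) by (auto simp: matching_families_def)
  assume Q: "presheaf Q" and k: "k \<le> h"
  show k': "k \<in> elems (fst p)"
    using down_closed_elems[of "fst p"] k assms(2) by (auto simp: down_closed_def)
  have "res Q k (inf k h) (snd p k) = res Q h (inf k h) (snd p h)"
    using m k' assms(2) by (auto simp: matching_families_def)
  moreover have "snd p k \<in> sec Q k" using m k' by (auto simp: matching_families_def)
  ultimately show "snd p k = res Q h k (snd p h)"
    using presheafD(2)[OF Q] k by (simp add: inf_absorb1)
qed

text \<open>The matching family generated by one section q, as in the Yoneda lemma. It is the
  witness wherever a point of \<open>Delta_Pre Q\<close> with a prescribed value at h has to
  exist.\<close>

definition principal_family :: "('h::complete_heyting_algebra, 'x) psh \<Rightarrow> 'h \<Rightarrow> 'x \<Rightarrow>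
    'h downset \<times> ('h \<Rightarrow> 'x)" where
  "principal_family Q h q = (principal h, \<lambda>k\<in>{k. k \<le> h}. res Q h k q)"

lemma principal_family:
  assumes "presheaf Q" "q \<in> sec Q h"
  shows "principal_family Q h q \<in> coprod_Gamma Q"
    and "h \<in> elems (fst (principal_family Q h q))"
    and "snd (principal_family Q h q) h = q"
  using presheafD[OF assms]
  by (auto simp: principal_family_def Gamma_def matching_families_def)

section \<open>The functor \<open>Delta_Pre\<close> at a fixed stage\<close>

lemma mor_Delta_Pre: "on_mor Delta_Pre P Q s =
    Phi_fam (on_mor Delta_Inf (on_obj Gamma P) (on_obj Gamma Q) (on_mor Gamma P Q s))"
  and obj_Delta_Pre: "on_obj Delta_Pre P = Phi_fam (on_obj Delta_Inf (on_obj Gamma P))"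
  by (simp_all add: Delta_Pre_def func_comp_def Phi_def)

text \<open>The supremum in \<open>psh_eq\<close> is a union of down-closed sets on which the two
  families agree, so it contains h exactly when one such set does. Agreement at the single index h
  is enough, because it spreads to all of \<open>principal h\<close>.\<close>

lemma rel_mor_Delta_Pre:
  assumes P: "presheaf P" and Q: "presheaf Q" and s: "nat_trans P Q s"
  shows "(p', p) \<in> rel (on_mor Delta_Pre P Q s) h \<longleftrightarrow> p \<in> coprod_Gamma P \<and> p' \<in> coprod_Gamma Q \<and>
    h \<in> elems (fst p) \<and> h \<in> elems (fst p') \<and> snd p' h = s h (snd p h)"
proof -
  let ?y = "\<lambda>k\<in>elems (fst p). s k (snd p k)"
  have "(p', p) \<in> rel (on_mor Delta_Pre P Q s) h \<longleftrightarrow> p \<in> coprod_Gamma P \<and> p' \<in> coprod_Gamma Q \<and>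
      principal h \<le> psh_eq (on_obj Gamma Q) p' (graph (on_mor Gamma P Q s) p)"
    unfolding mor_Delta_Pre mor_Delta_Inf Phi_fam_def by (auto simp: rel_fam)
  also have "\<dots> \<longleftrightarrow> p \<in> coprod_Gamma P \<and> p' \<in> coprod_Gamma Q \<and> (\<exists>M. h \<in> elems M \<and>
      M \<le> fst p \<and> M \<le> fst p' \<and> restrict (snd p') (elems M) = restrict ?y (elems M))"
    unfolding principal_le_iff psh_eq_def elems_Sup by (auto simp: graph_def Gamma_def)
  also have "\<dots> \<longleftrightarrow> p \<in> coprod_Gamma P \<and> p' \<in> coprod_Gamma Q \<and>
      h \<in> elems (fst p) \<and> h \<in> elems (fst p') \<and> snd p' h = s h (snd p h)" (is "?L \<longleftrightarrow> ?R")
  proof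
    assume ?L
    then obtain M where M: "h \<in> elems M" "M \<le> fst p" "M \<le> fst p'"
      "restrict (snd p') (elems M) = restrict ?y (elems M)" by blast
    then have "h \<in> elems (fst p)" "h \<in> elems (fst p')" by (auto simp: downset_le_iff)
    then show ?R using \<open>?L\<close> M(1) fun_cong[OF M(4), of h] by simp
  next
    assume R: ?R
    then have p: "p \<in> coprod_Gamma P" "h \<in> elems (fst p)"
      and p': "p' \<in> coprod_Gamma Q" "h \<in> elems (fst p')" and eq: "snd p' h = s h (snd p h)"
      by blast+
    \<comment> \<open>Both values at k are restrictions from h, on the right by naturality of s;
      this makes \<open>principal h\<close> a possible M.\<close>
    have "snd p' k = ?y k" if "k \<le> h" for k
      using coprod_GammaD(2,3)[OF p P that] coprod_GammaD(3)[OF p' Q that]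
        nat_transD(2)[OF s coprod_GammaD(1)[OF p] that] eq by simp
    then have "restrict (snd p') (elems (principal h)) = restrict ?y (elems (principal h))"
      by (intro restrict_ext) simp
    moreover have "principal h \<le> fst p" "principal h \<le> fst p'"
      using p p' by (simp_all add: principal_le_iff)
    moreover have "h \<in> elems (principal h)" by simp
    ultimately show ?L using R by blast
  qed
  finally show ?thesis .
qed

lemma src_tgt_mor_Delta_Pre:
  "src (on_mor Delta_Pre P Q s) = coprod_Gamma P" "tgt (on_mor Delta_Pre P Q s) = coprod_Gamma Q"
  by (simp_all add: mor_Delta_Pre mor_Delta_Inf Phi_fam_def)

lemma Delta_Pre_ident:
  assumes "\<And>h x. x \<in> sec P h \<Longrightarrow> s h x = x"
  shows "on_mor Delta_Pre P P s = on_obj Delta_Pre P"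
proof -
  have "on_mor Gamma P P s A x = x" if "x \<in> sec (on_obj Gamma P) A" for A x
  proof -
    have x: "x \<in> (\<Pi>\<^sub>E k\<in>elems A. sec P k)"
      using that by (auto simp: Gamma_def matching_families_def)
    show ?thesis
    proof
      fix k
      show "on_mor Gamma P P s A x k = x k"
        \<comment> \<open>Off the index set both functions take the default value, since matching
          families are extensional.\<close>
        using PiE_mem[OF x, of k] PiE_arb[OF x, of k] assms by (simp add: Gamma_def)
    qed
  qed
  then show ?thesis by (simp add: mor_Delta_Pre obj_Delta_Pre Delta_Inf_ident)
qed

lemma nat_trans_ident: "presheaf P \<Longrightarrow> nat_trans P P (\<lambda>h x. x)"
  by (simp add: nat_trans_def)

lemma rel_obj_Delta_Pre:
  assumes "presheaf P"
  shows "(p', p) \<in> rel (on_obj Delta_Pre P) h \<longleftrightarrow> p \<in> coprod_Gamma P \<and> p' \<in> coprod_Gamma P \<and>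
    h \<in> elems (fst p) \<and> h \<in> elems (fst p') \<and> snd p' h = snd p h"
  using rel_mor_Delta_Pre[OF assms assms nat_trans_ident[OF assms]]
  by (simp add: Delta_Pre_ident)

lemma src_tgt_obj_Delta_Pre:
  "src (on_obj Delta_Pre P) = coprod_Gamma P" "tgt (on_obj Delta_Pre P) = coprod_Gamma P"
  by (simp_all add: obj_Delta_Pre obj_Delta_Inf Phi_fam_def)

lemma order_preserving_mor_Delta_Pre:
  assumes P: "presheaf P" and Q: "presheaf Q" and s: "nat_trans P Q s"
  shows "order_preserving (on_mor Delta_Pre P Q s)"
proof (rule order_preservingI)
  fix h k p' p assume r: "(p', p) \<in> rel (on_mor Delta_Pre P Q s) h"
  then show "p \<in> src (on_mor Delta_Pre P Q s) \<and> p' \<in> tgt (on_mor Delta_Pre P Q s)"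
    unfolding rel_mor_Delta_Pre[OF assms] src_tgt_mor_Delta_Pre by blast
  assume k: "k \<le> h"
  have p: "p \<in> coprod_Gamma P" "h \<in> elems (fst p)"
    and p': "p' \<in> coprod_Gamma Q" "h \<in> elems (fst p')" and eq: "snd p' h = s h (snd p h)"
    using r unfolding rel_mor_Delta_Pre[OF assms] by blast+
  show "(p', p) \<in> rel (on_mor Delta_Pre P Q s) k"
    unfolding rel_mor_Delta_Pre[OF assms]
    using p(1) p'(1) coprod_GammaD(2,3)[OF p P k] coprod_GammaD(2,3)[OF p' Q k] eq
      nat_transD(2)[OF s coprod_GammaD(1)[OF p] k] by simp
qed

lemma rel_presheaf_Delta_Pre:
  assumes "presheaf P"
  shows "rel_presheaf (on_obj Delta_Pre P)"
proof -
  have "order_preserving (on_obj Delta_Pre P)"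
    using order_preserving_mor_Delta_Pre[OF assms assms nat_trans_ident[OF assms]]
    by (simp add: Delta_Pre_ident)
  then show ?thesis
    unfolding rel_presheaf_iff rel_obj_Delta_Pre[OF assms] src_tgt_obj_Delta_Pre by simp
qed

lemma hom_Delta_Pre:
  assumes P: "presheaf P" and Q: "presheaf Q" and s: "nat_trans P Q s"
  shows "on_mor Delta_Pre P Q s \<in> hom_Ord (on_obj Delta_Pre P) (on_obj Delta_Pre Q)"
proof -
  have "\<exists>p'. p' \<in> coprod_Gamma Q \<and> h \<in> elems (fst p') \<and> snd p' h = s h (snd p h)"
    if "p \<in> coprod_Gamma P" "h \<in> elems (fst p)" for p h
    using principal_family[OF Q nat_transD(1)[OF s coprod_GammaD(1)[OF that]]] by blast
  then show ?thesis
    unfolding hom_Ord_iff[OF rel_presheaf_Delta_Pre[OF P] rel_presheaf_Delta_Pre[OF Q]]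
      rel_mor_Delta_Pre[OF assms] rel_obj_Delta_Pre[OF P] rel_obj_Delta_Pre[OF Q]
      src_tgt_mor_Delta_Pre src_tgt_obj_Delta_Pre
    using order_preserving_mor_Delta_Pre[OF assms] by (simp del: coproduct_iff)
qed

lemma nat_trans_comp:
  "nat_trans P Q s \<Longrightarrow> nat_trans Q R t \<Longrightarrow> nat_trans P R (\<lambda>h x. t h (s h x))"
  by (simp add: nat_trans_def)

lemma nat_trans_cong:
  assumes "nat_trans P Q s" "presheaf P" "\<And>h x. x \<in> sec P h \<Longrightarrow> r h x = s h x"
  shows "nat_trans P Q r"
  using assms by (simp add: nat_trans_def presheafD(1))

lemma Delta_Pre_comp:
  assumes P: "presheaf P" and Q: "presheaf Q" and R: "presheaf R"
    and s: "nat_trans P Q s" and t: "nat_trans Q R t"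
    and r: "\<And>h x. x \<in> sec P h \<Longrightarrow> r h x = t h (s h x)"
  shows "on_mor Delta_Pre P R r = ord_comp (on_mor Delta_Pre Q R t) (on_mor Delta_Pre P Q s)"
proof (rule relfam_eqI)
  fix h p'' p
  have r': "nat_trans P R r" using nat_trans_cong[OF nat_trans_comp[OF s t] P r] .
  \<comment> \<open>The intermediate point needed for the composite relation at stage h.\<close>
  have ex: "\<exists>p'. p' \<in> coprod_Gamma Q \<and> h \<in> elems (fst p') \<and> snd p' h = s h (snd p h)"
    if "p \<in> coprod_Gamma P" "h \<in> elems (fst p)"
    using principal_family[OF Q nat_transD(1)[OF s coprod_GammaD(1)[OF that]]] by blast
  show "(p'', p) \<in> rel (on_mor Delta_Pre P R r) h \<longleftrightarrow>
      (p'', p) \<in> rel (ord_comp (on_mor Delta_Pre Q R t) (on_mor Delta_Pre P Q s)) h"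
    unfolding rel_ord_comp[OF order_preserving_mor_Delta_Pre[OF Q R t]
        order_preserving_mor_Delta_Pre[OF P Q s]]
      rel_mor_Delta_Pre[OF P R r'] rel_mor_Delta_Pre[OF Q R t] rel_mor_Delta_Pre[OF P Q s]
    using r[OF coprod_GammaD(1), of p] ex by metis
qed (simp_all add: src_tgt_mor_Delta_Pre)

section \<open>The right adjoint as a functor\<close>

lemma is_functor_Delta_Pre_Theta_Inf:
  "is_functor Rel_Inf Rel_Ord (Delta_Pre \<circ>F Theta_Inf ::
    (('h::complete_heyting_algebra, 'b, 'b) relfam, _, _, _) func)"
  unfolding is_functor_def
proof (intro conjI category_Rel_Inf category_Rel_Ord ballI)
  fix F :: "('h, 'b, 'b) relfam" assume "F \<in> Obj Rel_Inf"
  then have F: "rel_sheaf F" by (simp add: Rel_Inf_def)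
  then show "on_obj (Delta_Pre \<circ>F Theta_Inf) F \<in> Obj Rel_Ord"
    by (simp add: Rel_Ord_def func_comp_def rel_presheaf_Delta_Pre presheaf_Theta_Inf)
  have "inf_comp F \<alpha> = \<alpha>" if "\<alpha> \<in> sec (on_obj Theta_Inf F) h" for h \<alpha>
    using that by (simp add: hom_Inf_def)
  then show "on_mor (Delta_Pre \<circ>F Theta_Inf) F F (Ident Rel_Inf F) =
      Ident Rel_Ord (on_obj (Delta_Pre \<circ>F Theta_Inf) F)"
    using Delta_Pre_ident[of "on_obj Theta_Inf F" "on_mor Theta_Inf F F F"]
    by (simp add: Rel_Ord_def Rel_Inf_def func_comp_def)
next
  fix F G :: "('h, 'b, 'b) relfam" and f
  assume "F \<in> Obj Rel_Inf" "G \<in> Obj Rel_Inf" "f \<in> Hom Rel_Inf F G"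
  then show "on_mor (Delta_Pre \<circ>F Theta_Inf) F G f \<in>
      Hom Rel_Ord (on_obj (Delta_Pre \<circ>F Theta_Inf) F) (on_obj (Delta_Pre \<circ>F Theta_Inf) G)"
    by (simp add: Rel_Ord_def Rel_Inf_def func_comp_def hom_Delta_Pre presheaf_Theta_Inf
        nat_trans_Theta_Inf)
next
  fix F G H :: "('h, 'b, 'b) relfam" and f g
  assume "F \<in> Obj Rel_Inf" "G \<in> Obj Rel_Inf" "H \<in> Obj Rel_Inf"
    "f \<in> Hom Rel_Inf F G" "g \<in> Hom Rel_Inf G H"
  then have *: "rel_sheaf F" "rel_sheaf G" "rel_sheaf H" "f \<in> hom_Inf F G" "g \<in> hom_Inf G H"
    by (simp_all add: Rel_Inf_def)
  have "inf_comp (inf_comp g f) \<alpha> = inf_comp g (inf_comp f \<alpha>)"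
    if "\<alpha> \<in> sec (on_obj Theta_Inf F) h" for h \<alpha>
    using hom_Inf_assoc[OF _ *(4,5,1,2), of \<alpha> "singleton_sheaf h"] that by simp
  then show "on_mor (Delta_Pre \<circ>F Theta_Inf) F H (Comp Rel_Inf g f) =
      Comp Rel_Ord (on_mor (Delta_Pre \<circ>F Theta_Inf) G H g) (on_mor (Delta_Pre \<circ>F Theta_Inf) F G f)"
    using * by (simp add: Rel_Ord_def Rel_Inf_def func_comp_def)
      (intro Delta_Pre_comp; simp add: presheaf_Theta_Inf nat_trans_Theta_Inf)
qed


section \<open>The adjunction between relational-presheaves and presheaves\<close>

text \<open>The column of F at a, cut down to stages below h. When a is related to itself at h, this
  is the section of \<open>Theta_Pre F\<close> named by a.\<close>

definition germ :: "('h::complete_heyting_algebra, 'a, 'a) relfam \<Rightarrow> 'h \<Rightarrow> 'a \<Rightarrow>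
    ('h downset, unit, 'a) relfam" where
  "germ F h a = row (src F) (\<lambda>b. inf (principal h) (holds F b a))"

lemma elems_germ:
  "rel_presheaf F \<Longrightarrow>
    k \<in> elems (inf (principal h) (holds F b a)) \<longleftrightarrow> k \<le> h \<and> (b, a) \<in> rel F k"
  by (simp add: elems_inf elems_holds rel_presheafD(2))

lemma germ_in_sec:
  assumes F: "rel_presheaf F" and a: "(a, a) \<in> rel F h"
  shows "germ F h a \<in> sec (on_obj Theta_Pre F) h"
proof -
  note f = rel_presheafD[OF F]
  have a': "(a, a) \<in> rel F k" if "k \<le> h" for k using order_preservingD(3)[OF f(2) a that] .
  have "a \<in> src F" using order_preservingD(1)[OF f(2) a] .
  then have "singleton_elt (src F) (holds F) (principal h) (\<lambda>b. inf (principal h) (holds F b a))"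
    unfolding singleton_elt_def downset_le_iff elems_Sup image_image UN_iff
      elems_inf[of "inf _ _"] elems_inf[of _ "inf _ _"] Int_iff elems_germ[OF F]
      elems_holds[OF f(2)] elems_principal mem_Collect_eq
    using f(3,4) a' by (intro conjI ballI allI impI) blast+
  then show ?thesis
    unfolding sec_Theta_Pre germ_def Psi_fam_obj[OF F] row_in_hom_Inf[OF hset_holds[OF F]] .
qed

text \<open>Once h belongs to the entry at a, this a represents the whole row: a stage in the entry
  at b relates b to a by single-valuedness (\<open>sub\<close>), and a stage below h relating b to a
  lies in the entry at b by extensionality (\<open>ext\<close>).\<close>

lemma germ_exhaust:
  assumes F: "rel_presheaf F" and \<alpha>: "\<alpha> \<in> sec (on_obj Theta_Pre F) h"
  obtains a where "(a, a) \<in> rel F h" "\<alpha> = germ F h a"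
proof -
  note e = elems_holds[OF rel_presheafD(2)[OF F]]
  obtain x where x: "\<alpha> = row (src F) x" "singleton_elt (src F) (holds F) (principal h) x"
    using \<alpha> hom_Inf_singletonE[OF _ hset_holds[OF F]] unfolding sec_Theta_Pre Psi_fam_obj[OF F]
    by metis
  then obtain a where a: "a \<in> src F" "h \<in> elems (x a)"
    unfolding singleton_elt_def principal_le_iff elems_Sup by auto
  have le: "k \<le> h" if "b \<in> src F" "k \<in> elems (x b)" for b k
    using x(2) that by (auto simp: singleton_elt_def downset_le_iff)
  have ext: "k \<in> elems (x b')"
    if "b \<in> src F" "b' \<in> src F" "(b', b) \<in> rel F k" "k \<in> elems (x b)" for b b' k
  proof -
    have "inf (holds F b' b) (x b) \<le> x b'"
      using x(2) that(1,2) unfolding singleton_elt_def by blast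
    then show ?thesis using that(3,4) by (simp add: downset_le_iff elems_inf e)
  qed
  have sub: "(b, b') \<in> rel F k"
    if "b \<in> src F" "b' \<in> src F" "k \<in> elems (x b)" "k \<in> elems (x b')" for b b' k
  proof -
    have "inf (x b) (x b') \<le> holds F b b'"
      using x(2) that(1,2) unfolding singleton_elt_def by blast
    then show ?thesis using that(3,4) by (simp add: downset_le_iff elems_inf e)
  qed
  have "x b = inf (principal h) (holds F b a)" if b: "b \<in> src F" for b
    unfolding downset_eq_iff elems_germ[OF F]
  proof
    fix k
    have "k \<in> elems (x a)" if "k \<le> h"
      using down_closed_elems[of "x a"] a(2) that by (auto simp: down_closed_def)
    then show "k \<in> elems (x b) \<longleftrightarrow> k \<le> h \<and> (b, a) \<in> rel F k"
      using le[OF b] sub[OF b a(1)] ext[OF a(1) b] by blast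
  qed
  then have "\<alpha> = germ F h a" by (simp add: x(1) germ_def row_eq_iff)
  with sub[OF a(1) a(1) a(2) a(2)] that show ?thesis by blast
qed

lemma germ_eqI:
  assumes F: "rel_presheaf F" and ab: "(a, b) \<in> rel F h"
  shows "germ F h a = germ F h b"
proof -
  note f = rel_presheafD[OF F]
  have "(a, b) \<in> rel F k" if "k \<le> h" for k using order_preservingD(3)[OF f(2) ab that] .
  then have "k \<le> h \<and> (c, a) \<in> rel F k \<longleftrightarrow> k \<le> h \<and> (c, b) \<in> rel F k" for c k
    using f(3,4) by meson
  then show ?thesis by (simp add: germ_def row_eq_iff downset_eq_iff elems_germ[OF F])
qed

text \<open>Compare the entries of the two germs at a, at the stage h.\<close>

lemma germ_eqD:
  assumes F: "rel_presheaf F" and a: "(a, a) \<in> rel F h" and eq: "germ F h a = germ F h b"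
  shows "(a, b) \<in> rel F h"
proof -
  have "a \<in> src F" using order_preservingD(1)[OF rel_presheafD(2)[OF F] a] .
  then have "h \<le> h \<and> (a, a) \<in> rel F h \<longleftrightarrow> h \<le> h \<and> (a, b) \<in> rel F h"
    using eq unfolding elems_germ[OF F, symmetric] germ_def row_eq_iff by simp
  with a show ?thesis by simp
qed

lemma res_germ:
  assumes "rel_presheaf F" "k \<le> h"
  shows "res (on_obj Theta_Pre F) h k (germ F h a) = germ F k a"
  unfolding res_Theta_Pre germ_def row_comp_singleton_map
  using assms by (auto simp: row_eq_iff downset_eq_iff elems_inf)

text \<open>At a stage k \<le> h, the entry at b' asks for some c related to a with value b'. By
  extensionality this says that b' is a value of a, and since b is one too, that b' and b are
  related by G.\<close>

lemma Psi_fam_germ: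
  assumes F: "rel_presheaf F" and G: "rel_presheaf G" and t: "\<theta> \<in> hom_Ord F G"
    and b: "(b, a) \<in> rel \<theta> h"
  shows "inf_comp (Psi_fam \<theta>) (germ F h a) = germ G h b"
proof -
  note f = rel_presheafD[OF F] and d = hom_OrdD[OF t F G]
  have b': "(b, a) \<in> rel \<theta> k" if "k \<le> h" for k using order_preservingD(3)[OF d(3) b that] .
  have "(SUP c\<in>src F. inf (holds \<theta> b' c) (inf (principal h) (holds F c a))) =
      inf (principal h) (holds G b' b)" (is "?l = ?r") for b'
    unfolding downset_eq_iff elems_germ[OF G]
  proof
    fix k
    have "k \<in> elems ?l \<longleftrightarrow> (\<exists>c\<in>src F. (b', c) \<in> rel \<theta> k \<and> k \<le> h \<and> (c, a) \<in> rel F k)"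
      unfolding elems_Sup image_image UN_iff elems_inf[of "holds \<theta> _ _"] Int_iff elems_germ[OF F]
        elems_holds[OF d(3)] mem_Collect_eq ..
    also have "\<dots> \<longleftrightarrow> k \<le> h \<and> (b', a) \<in> rel \<theta> k"
      using d(4,5) order_preservingD(1)[OF d(3)] d(1) by metis
    also have "\<dots> \<longleftrightarrow> k \<le> h \<and> (b', b) \<in> rel G k"
      using b' d(6,7) by blast
    finally show "k \<in> elems ?l \<longleftrightarrow> k \<le> h \<and> (b', b) \<in> rel G k" .
  qed
  then show ?thesis
    unfolding Psi_fam_hom[OF F G t] germ_def comp_row row_eq_iff by blast
qed

text \<open>Only the value of p at h is constrained at stage h, in accordance with
  \<open>rel_obj_Delta_Pre\<close>: families with the same value at h are identified there.\<close>

definition transpose :: "('h::complete_heyting_algebra, 'a, 'a) relfam \<Rightarrow> ('h, 'x) psh \<Rightarrow>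
    ('h \<Rightarrow> ('h downset, unit, 'a) relfam \<Rightarrow> 'x) \<Rightarrow> ('h, 'a, 'h downset \<times> ('h \<Rightarrow> 'x)) relfam" where
  "transpose F Q s = \<lparr> src = src F, tgt = coprod_Gamma Q, rel = (\<lambda>h. {(p, a). p \<in> coprod_Gamma Q \<and>
     h \<in> elems (fst p) \<and> (a, a) \<in> rel F h \<and> snd p h = s h (germ F h a)}) \<rparr>"

lemma src_tgt_transpose [simp]:
  "src (transpose F Q s) = src F" "tgt (transpose F Q s) = coprod_Gamma Q"
  by (simp_all add: transpose_def)

lemma rel_transpose:
  "(p, a) \<in> rel (transpose F Q s) h \<longleftrightarrow> p \<in> coprod_Gamma Q \<and> h \<in> elems (fst p) \<and>
    (a, a) \<in> rel F h \<and> snd p h = s h (germ F h a)"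
  by (simp add: transpose_def)

lemma transpose_in_hom_Ord:
  assumes F: "rel_presheaf F" and Q: "presheaf Q" and s: "nat_trans (on_obj Theta_Pre F) Q s"
  shows "transpose F Q s \<in> hom_Ord F (on_obj Delta_Pre Q)"
proof -
  note f = rel_presheafD[OF F]
  have op: "order_preserving (transpose F Q s)"
  proof (rule order_preservingI)
    fix h k p a assume r: "(p, a) \<in> rel (transpose F Q s) h"
    then have p: "p \<in> coprod_Gamma Q" "h \<in> elems (fst p)" and a: "(a, a) \<in> rel F h"
      and eq: "snd p h = s h (germ F h a)"
      unfolding rel_transpose by blast+
    show "a \<in> src (transpose F Q s) \<and> p \<in> tgt (transpose F Q s)"
      using p(1) order_preservingD(1)[OF f(2) a] by simp
    assume k: "k \<le> h"
    have "snd p k = s k (germ F k a)"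
      using coprod_GammaD(3)[OF p Q k] eq nat_transD(2)[OF s germ_in_sec[OF F a] k]
        res_germ[OF F k] by simp
    then show "(p, a) \<in> rel (transpose F Q s) k"
      unfolding rel_transpose
      using p(1) coprod_GammaD(2)[OF p Q k] order_preservingD(3)[OF f(2) a k] by blast
  qed
  have total: "\<exists>p. p \<in> coprod_Gamma Q \<and> h \<in> elems (fst p) \<and> (a, a) \<in> rel F h \<and>
      snd p h = s h (germ F h a)" if "(a, a) \<in> rel F h" for a h
    using principal_family[OF Q nat_transD(1)[OF s germ_in_sec[OF F that]]] that by blast
  \<comment> \<open>The relation sees a only through its germ, which gives extensionality in the
    source.\<close>
  have germ: "(a', a') \<in> rel F h \<and> germ F h a' = germ F h a" if "(a, a') \<in> rel F h" for a a' h
    using germ_eqI[OF F that] f(6)[OF that] by simp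
  show ?thesis
    unfolding hom_Ord_iff[OF F rel_presheaf_Delta_Pre[OF Q]] rel_obj_Delta_Pre[OF Q]
      rel_transpose src_tgt_transpose src_tgt_obj_Delta_Pre
    by (intro conjI; (rule refl | rule op | metis germ | metis total))
qed

text \<open>The section is the germ of some a, and the family generated by
  \<open>s h \<alpha>\<close> is related to that a. Equality of the transposes then forces its value
  at h to be \<open>s' h \<alpha>\<close> as well.\<close>

lemma transpose_inject:
  assumes F: "rel_presheaf F" and Q: "presheaf Q" and s: "nat_trans (on_obj Theta_Pre F) Q s"
    and eq: "transpose F Q s = transpose F Q s'" and \<alpha>: "\<alpha> \<in> sec (on_obj Theta_Pre F) h"
  shows "s h \<alpha> = s' h \<alpha>"
proof -
  obtain a where a: "(a, a) \<in> rel F h" "\<alpha> = germ F h a" using germ_exhaust[OF F \<alpha>] .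
  let ?p = "principal_family Q h (s h \<alpha>)"
  note p = principal_family[OF Q nat_transD(1)[OF s \<alpha>]]
  have "(?p, a) \<in> rel (transpose F Q s) h" unfolding rel_transpose using p a by simp
  then have "snd ?p h = s' h \<alpha>" unfolding eq rel_transpose using a by simp
  with p(3) show ?thesis by simp
qed

lemma ex_transpose_eq:
  assumes F: "rel_presheaf F" and Q: "presheaf Q" and t: "\<theta> \<in> hom_Ord F (on_obj Delta_Pre Q)"
  shows "\<exists>s. nat_trans (on_obj Theta_Pre F) Q s \<and> transpose F Q s = \<theta>"
proof -
  note f = rel_presheafD[OF F] and d = hom_OrdD[OF t F rel_presheaf_Delta_Pre[OF Q]]
  \<comment> \<open>This makes s well defined: equal germs have related representatives, so p is
    also a value of a', and single-valuedness identifies p and p' at stage h.\<close>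
  have unique: "snd p h = snd p' h"
    if "(p, a) \<in> rel \<theta> h" "(p', a') \<in> rel \<theta> h" "germ F h a = germ F h a'" for p p' a a' h
    using d(7)[OF d(5)[OF that(1) germ_eqD[OF F d(4)[OF that(1)] that(3)]] that(2)]
    unfolding rel_obj_Delta_Pre[OF Q] by simp
  \<comment> \<open>Single-valuedness applied to p twice shows that p exists at stage h, that is,
    that h is one of its indices.\<close>
  have mem: "p \<in> coprod_Gamma Q" "h \<in> elems (fst p)" if "(p, a) \<in> rel \<theta> h" for p a h
    using d(7)[OF that that] unfolding rel_obj_Delta_Pre[OF Q] by blast+
  define s where "s h \<alpha> = (SOME q. \<exists>a p. (p, a) \<in> rel \<theta> h \<and> \<alpha> = germ F h a \<and> q = snd p h)" for h \<alpha>
  have s: "s h (germ F h a) = snd p h" if "(p, a) \<in> rel \<theta> h" for h a p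
    unfolding s_def by (rule some_equality) (use that in blast, metis unique that)
  have "nat_trans (on_obj Theta_Pre F) Q s"
    unfolding nat_trans_def
  proof (intro conjI allI ballI impI)
    fix h \<alpha> assume "\<alpha> \<in> sec (on_obj Theta_Pre F) h"
    then obtain a where a: "(a, a) \<in> rel F h" "\<alpha> = germ F h a" by (rule germ_exhaust[OF F])
    obtain p where p: "(p, a) \<in> rel \<theta> h" using d(8)[OF a(1)] by blast
    show "s h \<alpha> \<in> sec Q h" using coprod_GammaD(1)[OF mem[OF p]] s[OF p] a(2) by simp
    fix k assume k: "k \<le> h"
    show "s k (res (on_obj Theta_Pre F) h k \<alpha>) = res Q h k (s h \<alpha>)"
      using s[OF order_preservingD(3)[OF d(3) p k]] s[OF p] coprod_GammaD(3)[OF mem[OF p] Q k]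
        a(2) res_germ[OF F k] by simp
  qed
  moreover have "transpose F Q s = \<theta>"
  proof (rule relfam_eqI)
    fix h p a
    show "(p, a) \<in> rel (transpose F Q s) h \<longleftrightarrow> (p, a) \<in> rel \<theta> h"
    proof
      assume "(p, a) \<in> rel (transpose F Q s) h"
      then have p: "p \<in> coprod_Gamma Q" "h \<in> elems (fst p)" "(a, a) \<in> rel F h"
        "snd p h = s h (germ F h a)" unfolding rel_transpose by blast+
      obtain p' where p': "(p', a) \<in> rel \<theta> h" using d(8)[OF p(3)] by blast
      \<comment> \<open>Both families have the value \<open>s h (germ F h a)\<close> at h, so
        extensionality of \<theta> in the target carries p' to p.\<close>
      have "(p, p') \<in> rel (on_obj Delta_Pre Q) h"
        unfolding rel_obj_Delta_Pre[OF Q] using p mem[OF p'] s[OF p'] by simp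
      then show "(p, a) \<in> rel \<theta> h" using d(6) p' by blast
    next
      assume r: "(p, a) \<in> rel \<theta> h"
      then show "(p, a) \<in> rel (transpose F Q s) h"
        unfolding rel_transpose using mem[OF r] s[OF r] d(4)[OF r] by simp
    qed
  qed (use d(1,2) in \<open>simp_all add: src_tgt_obj_Delta_Pre\<close>)
  ultimately show ?thesis by blast
qed

text \<open>By \<open>Psi_fam_germ\<close> the morphism f sends the germ of a' to the germ of any of
  its values a, so both sides test p' against the same element of Q'. The intermediate points are a
  value of a' under f and the family generated by s at its germ.\<close>

lemma transpose_natural:
  assumes F: "rel_presheaf F" "rel_presheaf F'" and Q: "presheaf Q" "presheaf Q'"
    and f: "f \<in> hom_Ord F' F" and g: "nat_trans Q Q' g" and s: "nat_trans (on_obj Theta_Pre F) Q s"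
    and r: "\<And>h \<alpha>. \<alpha> \<in> sec (on_obj Theta_Pre F') h \<Longrightarrow>
      r h \<alpha> = g h (s h (on_mor Theta_Pre F' F f h \<alpha>))"
  shows "transpose F' Q' r = ord_comp (on_mor Delta_Pre Q Q' g) (ord_comp (transpose F Q s) f)"
proof (rule relfam_eqI)
  fix h p' a'
  note d = hom_OrdD[OF f F(2,1)]
  note t = hom_OrdD(3)[OF transpose_in_hom_Ord[OF F(1) Q(1) s] F(1) rel_presheaf_Delta_Pre[OF Q(1)]]
  have r': "r h (germ F' h a') = g h (s h (germ F h a))" if "(a, a') \<in> rel f h" for a
    using r[OF germ_in_sec[OF F(2) d(4)[OF that]]] Psi_fam_germ[OF F(2,1) f that]
    by (simp add: mor_Theta_Pre_apply)
  have "(p', a') \<in> rel (transpose F' Q' r) h \<longleftrightarrow>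
      (\<exists>a p. (a, a') \<in> rel f h \<and> (p, a) \<in> rel (transpose F Q s) h \<and>
        (p', p) \<in> rel (on_mor Delta_Pre Q Q' g) h)" (is "?L \<longleftrightarrow> ?R")
  proof
    assume L: ?L
    then obtain a where a: "(a, a') \<in> rel f h" using d(8) unfolding rel_transpose by blast
    have aa: "(a, a) \<in> rel F h" using d(7)[OF a a] .
    let ?p = "principal_family Q h (s h (germ F h a))"
    note p = principal_family[OF Q(1) nat_transD(1)[OF s germ_in_sec[OF F(1) aa]]]
    have "(?p, a) \<in> rel (transpose F Q s) h" unfolding rel_transpose using p aa by simp
    moreover have "(p', ?p) \<in> rel (on_mor Delta_Pre Q Q' g) h"
      unfolding rel_mor_Delta_Pre[OF Q g] using L p r'[OF a] unfolding rel_transpose by simp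
    ultimately show ?R using a by blast
  next
    assume ?R
    then obtain a p where a: "(a, a') \<in> rel f h" and p: "(p, a) \<in> rel (transpose F Q s) h"
      "(p', p) \<in> rel (on_mor Delta_Pre Q Q' g) h" by blast
    then show ?L
      unfolding rel_transpose rel_mor_Delta_Pre[OF Q g] using r'[OF a] d(4)[OF a] by simp
  qed
  then show "(p', a') \<in> rel (transpose F' Q' r) h \<longleftrightarrow>
      (p', a') \<in> rel (ord_comp (on_mor Delta_Pre Q Q' g) (ord_comp (transpose F Q s) f)) h"
    unfolding rel_ord_comp[OF order_preserving_mor_Delta_Pre[OF Q g] order_preserving_ord_comp[OF t d(3)]]
      rel_ord_comp[OF t d(3)] by blast
qed (simp_all add: src_tgt_mor_Delta_Pre hom_OrdD(1)[OF f F(2,1)])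

theorem mainTheorem12:
  shows "left_adjoint
    (a_Rel :: (('h::complete_heyting_algebra, 'a, 'a) relfam, ('h, 'a, 'a) relfam, _, _) func)
    (Delta_Pre \<circ>F Theta_Inf ::
      (('h, 'b, 'b) relfam, ('h, 'b, 'b) relfam, _, _) func)"
  unfolding left_adjoint_def
proof (intro conjI is_functor_a_Rel is_functor_Delta_Pre_Theta_Inf exI allI impI)
  let ?\<phi> = "\<lambda>F G t. transpose F (on_obj Theta_Inf G) (rows t)"
  fix F :: "('h, 'a, 'a) relfam" and G :: "('h, 'b, 'b) relfam"
  assume "rel_presheaf F \<and> rel_sheaf G"
  then have F: "rel_presheaf F" and G: "rel_sheaf G" by auto
  note P = presheaf_Theta_Pre[OF F] and Q = presheaf_Theta_Inf[OF G]
  note rows = nat_trans_rows[OF P G]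
  have "bij_betw (?\<phi> F G) (hom_Inf (on_obj Delta_Inf (on_obj Theta_Pre F)) G)
      (hom_Ord F (on_obj Delta_Pre (on_obj Theta_Inf G)))"
    unfolding bij_betw_def
  proof
    show "inj_on (?\<phi> F G) (hom_Inf (on_obj Delta_Inf (on_obj Theta_Pre F)) G)"
    proof (rule inj_onI)
      fix t t'
      assume t: "t \<in> hom_Inf (on_obj Delta_Inf (on_obj Theta_Pre F)) G"
        "t' \<in> hom_Inf (on_obj Delta_Inf (on_obj Theta_Pre F)) G" and eq: "?\<phi> F G t = ?\<phi> F G t'"
      show "t = t'"
        using t transpose_inject[OF F Q rows[OF t(1)] eq] by (rule rows_inject)
    qed
    show "?\<phi> F G ` hom_Inf (on_obj Delta_Inf (on_obj Theta_Pre F)) G =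
        hom_Ord F (on_obj Delta_Pre (on_obj Theta_Inf G))"
    proof (intro equalityI subsetI)
      fix \<theta> assume "\<theta> \<in> hom_Ord F (on_obj Delta_Pre (on_obj Theta_Inf G))"
      then obtain s where s: "nat_trans (on_obj Theta_Pre F) (on_obj Theta_Inf G) s"
        "transpose F (on_obj Theta_Inf G) s = \<theta>"
        using ex_transpose_eq[OF F Q] by blast
      obtain t where t: "t \<in> hom_Inf (on_obj Delta_Inf (on_obj Theta_Pre F)) G"
        "\<And>h x. x \<in> sec (on_obj Theta_Pre F) h \<Longrightarrow> rows t h x = s h x"
        using ex_hom_rows_eq[OF P G s(1)] by blast
      \<comment> \<open>The rows of t agree with s on sections only; this suffices, since
        \<open>transpose\<close> evaluates them only at germs of points related to themselves, which
        are sections.\<close>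
      have "?\<phi> F G t = \<theta>"
        unfolding s(2)[symmetric] using t(2) germ_in_sec[OF F]
        by (intro relfam_eqI) (auto simp: rel_transpose simp del: coproduct_iff)
      with t(1) show "\<theta> \<in> ?\<phi> F G ` hom_Inf (on_obj Delta_Inf (on_obj Theta_Pre F)) G" by blast
    qed (use transpose_in_hom_Ord[OF F Q rows] in blast)
  qed
  then show "bij_betw (?\<phi> F G) (hom_Inf (on_obj a_Rel F) G)
      (hom_Ord F (on_obj (Delta_Pre \<circ>F Theta_Inf) G))"
    by (simp add: obj_a_Rel func_comp_def)
next
  let ?\<phi> = "\<lambda>F G t. transpose F (on_obj Theta_Inf G) (rows t)"
  fix F F' :: "('h, 'a, 'a) relfam" and G G' :: "('h, 'b, 'b) relfam" and f g t
  assume "rel_presheaf F \<and> rel_presheaf F' \<and> rel_sheaf G \<and> rel_sheaf G' \<and>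
    f \<in> hom_Ord F' F \<and> g \<in> hom_Inf G G' \<and> t \<in> hom_Inf (on_obj a_Rel F) G"
  then have F: "rel_presheaf F" "rel_presheaf F'" and G: "rel_sheaf G" "rel_sheaf G'"
    and f: "f \<in> hom_Ord F' F" and g: "g \<in> hom_Inf G G'"
    and t: "t \<in> hom_Inf (on_obj Delta_Inf (on_obj Theta_Pre F)) G"
    by (simp_all add: obj_a_Rel)
  note P = presheaf_Theta_Pre[OF F(1)] presheaf_Theta_Pre[OF F(2)]
    and Q = presheaf_Theta_Inf[OF G(1)] presheaf_Theta_Inf[OF G(2)]
  have "?\<phi> F' G' (inf_comp g (inf_comp t (on_mor a_Rel F' F f))) =
      ord_comp (on_mor Delta_Pre (on_obj Theta_Inf G) (on_obj Theta_Inf G')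
        (on_mor Theta_Inf G G' g)) (ord_comp (?\<phi> F G t) f)"
    unfolding mor_a_Rel
    using rows_natural[OF P G nat_trans_Theta_Pre[OF F(2,1) f] t g]
    by (intro transpose_natural[OF F Q f nat_trans_Theta_Inf[OF G g] nat_trans_rows[OF P(1) G(1) t]])
      simp
  then show "?\<phi> F' G' (inf_comp g (inf_comp t (on_mor a_Rel F' F f))) =
      ord_comp (on_mor (Delta_Pre \<circ>F Theta_Inf) G G' g) (ord_comp (?\<phi> F G t) f)"
    by (simp add: func_comp_def)
qed

end
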